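(* Let $\alpha>1$ and $r\ge2$. Let $P$ be an $r$-pattern, and let $\mathcal{F}$ be a family of $r$-graphs, none of whose members has an isolated vertex, that is degree-stable with respect to $\mathrm{Col}(P)$. Then for all sufficiently large $n$ and any $n$-vertex $\mathcal{F}$-free $r$-graph $G$, $$\lambda^{(\alpha)}(G)\le\lambda^{(\alpha)}(\mathrm{Col}(P),n),$$ where equality holds only if $G$ is $P$-colorable.
   Context: An $r$-graph is a finite $r$-uniform hypergraph; $\delta(G)$ is its minimum degree. An $r$-graph is $\mathcal{F}$-free if it contains no (not necessarily induced) subgraph isomorphic to a member of $\mathcal{F}$. The Turán number $ex(n,\mathcal{F})$ is the maximum number of edges of an $n$-vertex $\mathcal{F}$-free $r$-graph, and $\pi(\mathcal{F})=\lim_{n\to\infty}ex(n,\mathcal{F})/\binom nr$. For an $r$-graph $G$ with vertex set $[n]$ let $P_G(\mathbf{x})=r!\sum_{\{i_1,\dots,i_r\}\in E(G)}x_{i_1}\cdots x_{i_r}$; the $\alpha$-spectral radius is $\lambda^{(\alpha)}(G)=\max\{P_G(\mathbf{x}):\mathbf{x}\in\mathbb{R}^n,\ |x_1|^\alpha+\dots+|x_n|^\alpha=1\}$. An $r$-pattern is a pair $P=([l],E)$ with $l$ a positive integer and $E$ a set of $r$-multisets (multisets of cardinality $r$) with elements from $[l]$. An $r$-graph $H$ is $P$-colorable if there is a map $\phi:V(H)\to[l]$ such that for every edge $\{v_1,\dots,v_r\}\in E(H)$ the multiset $\{\phi(v_1),\dots,\phi(v_r)\}$ belongs to $E$. $\mathrm{Col}(P)$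 is the family of all $P$-colorable $r$-graphs, and $\lambda^{(\alpha)}(\mathrm{Col}(P),n)$ is the maximum of $\lambda^{(\alpha)}(H)$ over $n$-vertex $H\in\mathrm{Col}(P)$. Degree stability: let $\mathcal{F}$ be a family of $r$-graphs with $\pi(\mathcal{F})>0$ and let $\mathfrak{H}$ be a family of $\mathcal{F}$-free $r$-graphs. $\mathcal{F}$ is degree-stable with respect to $\mathfrak{H}$ if there exist constants $n_0$ and $\varepsilon>0$ such that every $\mathcal{F}$-free $r$-graph $\mathcal{H}$ on $n\ge n_0$ vertices with $\delta(\mathcal{H})\ge(\pi(\mathcal{F})/(r-1)!-\varepsilon)n^{r-1}$ is a member of $\mathfrak{H}$. (So the hypothesis includes that $\pi(\mathcal{F})>0$ and that all members of $\mathrm{Col}(P)$ are $\mathcal{F}$-free.) *)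

theory Defs
  imports "HOL-Analysis.Analysis" "HOL-Library.Multiset"
begin

text \<open>Hypergraphs are pairs of a vertex set and an edge set. Up to isomorphism every finite
  hypergraph has natural numbers as vertices, so families of hypergraphs are sets of hypergraphs
  on finite (arbitrary, not only initial) sets of natural numbers.\<close>

type_synonym hypergraph = "nat set \<times> nat set set"

abbreviation verts :: "hypergraph \<Rightarrow> nat set" where "verts \<equiv> fst"

abbreviation edges :: "hypergraph \<Rightarrow> nat set set" where "edges \<equiv> snd"

definition r_graph :: "nat \<Rightarrow> hypergraph \<Rightarrow> bool" where
  "r_graph r G \<longleftrightarrow> finite (verts G) \<and> (\<forall>e\<in>edges G. e \<subseteq> verts G \<and> card e = r)"

definition vertex_degree :: "hypergraph \<Rightarrow> nat \<Rightarrow> nat" where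
  "vertex_degree G v = card {e \<in> edges G. v \<in> e}"

definition min_degree :: "hypergraph \<Rightarrow> nat" where
  "min_degree G = Min (vertex_degree G ` verts G)"

definition has_isolated_vertex :: "hypergraph \<Rightarrow> bool" where
  "has_isolated_vertex G \<longleftrightarrow> (\<exists>v\<in>verts G. \<forall>e\<in>edges G. v \<notin> e)"

definition subgraph :: "hypergraph \<Rightarrow> hypergraph \<Rightarrow> bool" where
  "subgraph H G \<longleftrightarrow> verts H \<subseteq> verts G \<and> edges H \<subseteq> edges G"

definition isomorphic :: "hypergraph \<Rightarrow> hypergraph \<Rightarrow> bool" where
  "isomorphic H G \<longleftrightarrow> (\<exists>f. bij_betw f (verts H) (verts G) \<and> edges G = (\<lambda>e. f ` e) ` edges H)"

definition family_free :: "hypergraph set \<Rightarrow> hypergraph \<Rightarrow> bool" where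
  "family_free \<F> G \<longleftrightarrow> \<not> (\<exists>F\<in>\<F>. \<exists>H. subgraph H G \<and> isomorphic F H)"

definition turan_number :: "nat \<Rightarrow> nat \<Rightarrow> hypergraph set \<Rightarrow> nat" where
  "turan_number r n \<F> =
     Max {card (edges G) | G. r_graph r G \<and> card (verts G) = n \<and> family_free \<F> G}"

definition turan_density :: "nat \<Rightarrow> hypergraph set \<Rightarrow> real" where
  "turan_density r \<F> = lim (\<lambda>n. real (turan_number r n \<F>) / real (n choose r))"

definition degree_stable :: "nat \<Rightarrow> hypergraph set \<Rightarrow> hypergraph set \<Rightarrow> bool" where
  "degree_stable r \<F> \<HH> \<longleftrightarrow>
     (\<forall>F\<in>\<F>. r_graph r F) \<and> turan_density r \<F> > 0 \<and>
     (\<forall>H\<in>\<HH>. r_graph r H \<and> family_free \<F> H) \<and>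
     (\<exists>n\<^sub>0::nat. \<exists>\<epsilon>::real. \<epsilon> > 0 \<and>
        (\<forall>n\<ge>n\<^sub>0. \<forall>H. r_graph r H \<and> card (verts H) = n \<and> family_free \<F> H \<and>
           real (min_degree H) \<ge> (turan_density r \<F> / fact (r - 1) - \<epsilon>) * real n ^ (r - 1)
           \<longrightarrow> H \<in> \<HH>))"

text \<open>The pair \<open>(l, E)\<close> stands for the pattern \<open>([l], E)\<close> with \<open>[l] = {1..l}\<close>.\<close>

type_synonym pattern = "nat \<times> nat multiset set"

definition is_pattern :: "nat \<Rightarrow> pattern \<Rightarrow> bool" where
  "is_pattern r P \<longleftrightarrow> fst P > 0 \<and> (\<forall>M\<in>snd P. size M = r \<and> set_mset M \<subseteq> {1..fst P})"

definition colorable :: "pattern \<Rightarrow> hypergraph \<Rightarrow> bool" where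
  "colorable P H \<longleftrightarrow>
     (\<exists>\<phi>. \<phi> ` verts H \<subseteq> {1..fst P} \<and> (\<forall>e\<in>edges H. image_mset \<phi> (mset_set e) \<in> snd P))"

definition Col :: "nat \<Rightarrow> pattern \<Rightarrow> hypergraph set" where
  "Col r P = {H. r_graph r H \<and> colorable P H}"

definition edge_poly :: "nat \<Rightarrow> hypergraph \<Rightarrow> (nat \<Rightarrow> real) \<Rightarrow> real" where
  "edge_poly r G x = fact r * (\<Sum>e\<in>edges G. \<Prod>v\<in>e. x v)"

text \<open>A real vector indexed by the vertices of \<open>G\<close> is a function \<open>nat \<Rightarrow> real\<close>, whose values outside
  \<open>verts G\<close> play no role. The supremum below is a maximum whenever \<open>verts G\<close> is nonempty, see
  \<open>spectral_radius_attained\<close>. For \<open>\<alpha> > 0\<close>, \<open>0 powr \<alpha> = 0\<close> agrees with the usual power.\<close>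

definition spectral_radius :: "real \<Rightarrow> nat \<Rightarrow> hypergraph \<Rightarrow> real" where
  "spectral_radius \<alpha> r G = Sup {edge_poly r G x | x. (\<Sum>v\<in>verts G. \<bar>x v\<bar> powr \<alpha>) = 1}"

text \<open>The set below is finite, as the spectral radius is invariant under isomorphism.\<close>

definition family_spectral_radius :: "real \<Rightarrow> nat \<Rightarrow> hypergraph set \<Rightarrow> nat \<Rightarrow> real" where
  "family_spectral_radius \<alpha> r \<HH> n = Max {spectral_radius \<alpha> r H | H. H \<in> \<HH> \<and> card (verts H) = n}"

lemma spectral_radius_attained:
  assumes "\<alpha> > 0" "r_graph r G" "verts G \<noteq> {}"
  shows "\<exists>x. (\<Sum>v\<in>verts G. \<bar>x v\<bar> powr \<alpha>) = 1 \<and> spectral_radius \<alpha> r G = edge_poly r G x \<and>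
    (\<forall>y. (\<Sum>v\<in>verts G. \<bar>y v\<bar> powr \<alpha>) = 1 \<longrightarrow> edge_poly r G y \<le> edge_poly r G x)"
proof -
  let ?V = "verts G" and ?p = "edge_poly r G"
  let ?n = "\<lambda>x. \<Sum>v\<in>verts G. \<bar>x v\<bar> powr \<alpha>"
  define B where "B = (\<lambda>v. if v \<in> ?V then {-1..1} else {0::real})"
  define S where "S = PiE UNIV B \<inter> {x. ?n x = 1}"
  have fin: "finite ?V" and sub: "\<And>e. e \<in> edges G \<Longrightarrow> e \<subseteq> ?V"
    using assms(2) by (auto simp: r_graph_def)
  have "compactin (product_topology (\<lambda>_. euclidean) UNIV) (PiE UNIV B)"
    by (subst compactin_PiE) (auto simp: B_def)
  then have "compact (PiE UNIV B)"
    by (simp add: euclidean_product_topology)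
  moreover have "continuous_on UNIV ?n"
    using \<open>\<alpha> > 0\<close> by (intro continuous_intros continuous_on_powr') auto
  then have "closed (?n -` {1})"
    by (simp add: continuous_on_closed_vimage)
  then have "closed {x. ?n x = 1}"
    by (simp add: vimage_def)
  ultimately have cpt: "compact S"
    unfolding S_def by (rule compact_Int_closed)
  obtain u where u: "u \<in> ?V"
    using assms(3) by blast
  have "?n (\<lambda>v. if v = u then 1 else 0) = (\<Sum>v\<in>?V. if v = u then 1 else 0)"
    by (intro sum.cong) auto
  then have "?n (\<lambda>v. if v = u then 1 else 0) = 1"
    using u fin by simp
  then have "(\<lambda>v. if v = u then 1 else 0) \<in> S"
    using u by (auto simp: S_def B_def PiE_def)
  then have ne: "S \<noteq> {}"
    by blast
  have "continuous_on S ?p"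
    unfolding edge_poly_def
    by (intro continuous_intros continuous_on_subset[OF continuous_on_product_coordinates]) auto
  from continuous_attains_sup[OF cpt ne this]
  obtain x where x: "x \<in> S" and mx: "\<And>y. y \<in> S \<Longrightarrow> ?p y \<le> ?p x"
    by blast
  have nx: "?n x = 1"
    using x by (simp add: S_def)
  have le: "?p y \<le> ?p x" if y: "?n y = 1" for y
  proof -
    define z where "z = (\<lambda>v. if v \<in> ?V then y v else 0)"
    have "\<bar>y v\<bar> \<le> 1" if "v \<in> ?V" for v
    proof (rule ccontr)
      assume "\<not> \<bar>y v\<bar> \<le> 1"
      then have "1 < \<bar>y v\<bar> powr \<alpha>"
        using \<open>\<alpha> > 0\<close> by (simp add: gr_one_powr)
      also have "\<dots> \<le> ?n y"
        by (rule member_le_sum[OF that _ fin]) simp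
      finally show False
        using y by simp
    qed
    then have "z \<in> PiE UNIV B"
      by (auto simp: z_def B_def PiE_def abs_le_iff)
    moreover have "?n z = ?n y"
      by (intro sum.cong) (auto simp: z_def)
    ultimately have "z \<in> S"
      using y by (simp add: S_def)
    moreover have "?p z = ?p y"
      unfolding edge_poly_def z_def
      using sub by (intro arg_cong2[where f = "(*)"] refl sum.cong prod.cong) (auto simp: subset_iff)
    ultimately show ?thesis
      using mx by metis
  qed
  have "spectral_radius \<alpha> r G = ?p x"
    unfolding spectral_radius_def using nx le by (intro cSup_eq_maximum) blast+
  then show ?thesis
    using nx le by blast
qed

end

theory Submission
  imports Defs
begin

text \<open>Normalise the spectral radius of a \<open>k\<close>-vertex graph by its value on the complete graph with
  constant weights; call the result its density. Deleting a vertex whose weight \<open>y v\<close> in an optimal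
  weighting satisfies \<open>y v \<le> b < 1\<close> (the average of \<open>y v powr \<alpha>\<close> being 1) multiplies the density by
  at least \<open>1 + c/k\<close>; here \<open>\<alpha> > 1\<close> is used. If there is no such vertex and the density is at least
  the Turan density, the eigenvector equation bounds all degrees from below and degree stability
  makes the graph colorable. As the harmonic series diverges and the density is bounded, repeated
  deletion ends at a colorable graph which is still large. On the other hand cloning the heaviest
  vertex keeps a graph colorable, so the best density of colorable graphs decreases by a factor of at
  most \<open>1 - O(1/k\<^sup>2)\<close> per vertex. Started from a graph at least as dense as all colorable graphs of its
  order, a process with at least one deletion would therefore end at a colorable graph strictly
  denser than all colorable graphs of its order, itself included.\<close>

section \<open>Inequalities for powers and elementary symmetric sums\<close>

text \<open>Bernoulli's inequality: a convex function lies above its tangent at 1. Convexity is used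
  on the open half-line, so \<open>x = 0\<close> is handled on its own.\<close>

lemma powr_ge_tangent:
  fixes x p :: real
  assumes "p \<ge> 1" "x \<ge> 0"
  shows "x powr p \<ge> 1 + p * (x - 1)"
proof (cases "x = 0")
  case False
  then have x: "x > 0" using assms by simp
  have "x powr p - 1 powr p \<ge> p * (x - 1)"
  proof (rule convex_on_imp_above_tangent[OF powr_convex[OF assms(1)]])
    have "((\<lambda>x. x powr p) has_real_derivative p) (at 1)"
      by (rule derivative_eq_intros refl | simp)+
    then show "((\<lambda>x. x powr p) has_real_derivative p) (at 1 within {0<..})"
      by (rule DERIV_subset) simp
  qed (use x in \<open>auto simp: interior_open\<close>)
  then show ?thesis by simp
qed (use assms in simp)

text \<open>The exponent will be \<open>r / \<alpha>\<close>, which may be below 1. As the base is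
  at most 1, raising the exponent to \<open>max s 1\<close> only lowers the power, and Bernoulli's
  inequality applies.\<close>

lemma one_minus_powr_ge:
  fixes y s :: real
  assumes "0 \<le> y" "y \<le> 1" "s > 0"
  shows "(1 - y) powr s \<ge> 1 - max s 1 * y"
proof -
  have "1 - max s 1 * y \<le> (1 - y) powr max s 1"
    using powr_ge_tangent[of "max s 1" "1 - y"] assms by (simp add: algebra_simps)
  also have "\<dots> \<le> (1 - y) powr s"
  proof (cases "y = 1")
    case False
    then show ?thesis
    using assms by (intro powr_mono') auto
  qed (use assms in auto)
  finally show ?thesis .
qed

text \<open>The power mean inequality, obtained by adding up the tangents at 1.\<close>

lemma sum_le_card_if_sum_powr_eq_card:
  fixes y :: "'a \<Rightarrow> real"
  assumes "p \<ge> 1" "finite V" "\<And>v. v \<in> V \<Longrightarrow> y v \<ge> 0"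
    and "(\<Sum>v\<in>V. y v powr p) = card V"
  shows "sum y V \<le> card V"
proof -
  have "(\<Sum>v\<in>V. 1 + p * (y v - 1)) \<le> card V"
    unfolding assms(4)[symmetric] using assms by (intro sum_mono powr_ge_tangent) auto
  then have "p * (sum y V - card V) \<le> 0"
    by (simp add: sum.distrib sum_subtractf flip: sum_distrib_left)
  then show ?thesis using assms(1) by (simp add: mult_le_0_iff)
qed

text \<open>Once the terms of degree 0 and 1 in \<open>x\<close> are removed, the binomial expansion
  of \<open>(X + x) ^ Suc q\<close> still has nonnegative coefficients, hence is monotone in both
  variables.\<close>

lemma power_add_diff_ge:
  fixes X x A a :: real
  assumes "0 \<le> a" "a \<le> x" "0 \<le> A" "A \<le> X"
  shows "X ^ Suc q - A ^ Suc q + real (Suc q) * (x * X ^ q - a * A ^ q)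
    \<le> (X + x) ^ Suc q - (A + a) ^ Suc q"
proof (cases q)
  case (Suc p)
  have e: "(Y + y) ^ Suc (Suc p) = Y ^ Suc (Suc p) + real (Suc (Suc p)) * (y * Y ^ Suc p)
     + (\<Sum>i\<le>p. real (Suc (Suc p) choose Suc (Suc i)) * y ^ Suc (Suc i) * Y ^ (p - i))" for Y y :: real
    unfolding add.commute[of Y] binomial_ring
    by (subst sum.atMost_Suc_shift, subst sum.atMost_Suc_shift) (simp add: algebra_simps)
  have "(\<Sum>i\<le>p. real (Suc (Suc p) choose Suc (Suc i)) * a ^ Suc (Suc i) * A ^ (p - i))
    \<le> (\<Sum>i\<le>p. real (Suc (Suc p) choose Suc (Suc i)) * x ^ Suc (Suc i) * X ^ (p - i))"
    using assms by (intro sum_mono mult_mono mult_left_mono power_mono mult_nonneg_nonneg) auto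
  then show ?thesis unfolding Suc e by (simp add: algebra_simps)
qed simp

lemma fact_times_choose_le_power: "fact q * (n choose q) \<le> (n::nat) ^ q"
  by (metis binomial_fact_pow mult.commute)

lemma card_Suc_subsets_insert:
  assumes "finite V" "v \<notin> V"
  shows "{S. S \<subseteq> insert v V \<and> card S = Suc q} =
    {S. S \<subseteq> V \<and> card S = Suc q} \<union> insert v ` {S. S \<subseteq> V \<and> card S = q}"
proof (intro set_eqI iffI)
  fix S assume S: "S \<in> {S. S \<subseteq> insert v V \<and> card S = Suc q}"
  then have f: "finite S" using assms finite_subset[of S "insert v V"] by simp
  show "S \<in> {S. S \<subseteq> V \<and> card S = Suc q} \<union> insert v ` {S. S \<subseteq> V \<and> card S = q}"
  proof (cases "v \<in> S")
    case True
    then have "S - {v} \<in> {S. S \<subseteq> V \<and> card S = q}"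
      using S f by auto
    moreover have "S = insert v (S - {v})" using True by blast
    ultimately show ?thesis by blast
  qed (use S in auto)
next
  fix S assume S: "S \<in> {S. S \<subseteq> V \<and> card S = Suc q} \<union> insert v ` {S. S \<subseteq> V \<and> card S = q}"
  then show "S \<in> {S. S \<subseteq> insert v V \<and> card S = Suc q}"
    using assms finite_subset[OF _ assms(1)] by (fastforce simp: card_insert_if)
qed

text \<open>Expanding \<open>sum x V ^ q\<close> gives \<open>fact q\<close> times the elementary
  symmetric sum plus monomials with a repeated variable; the latter do not increase when every
  \<open>x v\<close> is lowered to \<open>a\<close>. The proof adds the elements of \<open>V\<close>
  one at a time.\<close>

lemma sum_subset_prod_diff_le:
  fixes x :: "'a \<Rightarrow> real" and a :: real
  assumes "finite V" "0 \<le> a" "\<And>v. v \<in> V \<Longrightarrow> a \<le> x v"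
  shows "fact q * (\<Sum>S | S \<subseteq> V \<and> card S = q. prod x S - a ^ q) \<le> sum x V ^ q - (card V * a) ^ q"
  using assms(1,3)
proof (induction V arbitrary: q rule: finite_induct)
  case empty
  then show ?case by (cases q) (auto simp: Collect_conv_if)
next
  case (insert v V)
  show ?case
  proof (cases q)
    case 0
    have "{S. S \<subseteq> insert v V \<and> card S = 0} = {{}}"
      using insert.hyps by (auto dest: finite_subset)
    then show ?thesis by (simp add: 0)
  next
    case (Suc p)
    let ?N = "\<lambda>q. {S. S \<subseteq> V \<and> card S = q}"
    let ?X = "sum x V" and ?A = "real (card V) * a"
    have fin: "finite (?N k)" for k using insert.hyps by simp
    have ax: "a \<le> x v" using insert.prems by simp
    have AX: "?A \<le> ?X" using sum_bounded_below[of V a x] insert.prems by simp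
    have IH: "fact k * (\<Sum>S\<in>?N k. prod x S - a ^ k) \<le> ?X ^ k - ?A ^ k" for k
      using insert by auto
    have inj: "inj_on (insert v) (?N p)"
      using insert.hyps by (intro inj_onI) (auto dest!: insert_ident[THEN iffD1, rotated 2])
    have "(\<Sum>S | S \<subseteq> insert v V \<and> card S = Suc p. prod x S - a ^ Suc p) =
       (\<Sum>S\<in>?N (Suc p). prod x S - a ^ Suc p) + (\<Sum>S\<in>?N p. prod x (insert v S) - a ^ Suc p)"
      unfolding card_Suc_subsets_insert[OF insert.hyps]
      using fin insert.hyps inj by (subst sum.union_disjoint) (auto simp: sum.reindex)
    \<comment> \<open>The factors in \<open>S\<close> are changed first and the factor at
      \<open>v\<close> afterwards: the induction hypothesis for \<open>p\<close> handles the first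
      part, counting \<open>p\<close>-subsets the second.\<close>
    also have "(\<Sum>S\<in>?N p. prod x (insert v S) - a ^ Suc p) =
       (\<Sum>S\<in>?N p. x v * (prod x S - a ^ p) + (x v - a) * a ^ p)"
    proof (intro sum.cong refl)
      fix S assume "S \<in> ?N p"
      then have "finite S" "v \<notin> S" using insert.hyps by (auto dest: finite_subset)
      then show "prod x (insert v S) - a ^ Suc p = x v * (prod x S - a ^ p) + (x v - a) * a ^ p"
        by (simp add: algebra_simps)
    qed
    also have "\<dots> = x v * (\<Sum>S\<in>?N p. prod x S - a ^ p) + (x v - a) * a ^ p * (card V choose p)"
      using insert.hyps by (simp add: sum.distrib n_subsets flip: sum_distrib_left)
    finally have s: "(\<Sum>S | S \<subseteq> insert v V \<and> card S = Suc p. prod x S - a ^ Suc p) =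
      (\<Sum>S\<in>?N (Suc p). prod x S - a ^ Suc p) + (x v * (\<Sum>S\<in>?N p. prod x S - a ^ p)
        + (x v - a) * a ^ p * (card V choose p))" .
    have c: "fact p * real (card V choose p) \<le> real (card V) ^ p"
      using fact_times_choose_le_power[of p "card V"]
      by (metis of_nat_fact of_nat_le_iff of_nat_mult of_nat_power)
    have "fact (Suc p) * (\<Sum>S | S \<subseteq> insert v V \<and> card S = Suc p. prod x S - a ^ Suc p) =
      fact (Suc p) * (\<Sum>S\<in>?N (Suc p). prod x S - a ^ Suc p)
      + real (Suc p) * (x v * (fact p * (\<Sum>S\<in>?N p. prod x S - a ^ p)))
      + real (Suc p) * ((x v - a) * (a ^ p * (fact p * real (card V choose p))))"
      unfolding s fact_Suc by (simp only: of_nat_mult ring_distribs mult_ac)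
    also have "\<dots> \<le> (?X ^ Suc p - ?A ^ Suc p) + real (Suc p) * (x v * (?X ^ p - ?A ^ p))
       + real (Suc p) * ((x v - a) * (a ^ p * real (card V) ^ p))"
      by (rule add_mono[OF add_mono[OF IH mult_left_mono[OF mult_left_mono[OF IH]]]
            mult_left_mono[OF mult_left_mono[OF mult_left_mono[OF c]]]])
         (use ax assms(2) in auto)
    also have "\<dots> = ?X ^ Suc p - ?A ^ Suc p + real (Suc p) * (x v * ?X ^ p - a * ?A ^ p)"
      by (simp add: algebra_simps)
    also have "\<dots> \<le> (?X + x v) ^ Suc p - (?A + a) ^ Suc p"
      using assms(2) ax AX by (intro power_add_diff_ge) auto
    also have "\<dots> = sum x (insert v V) ^ Suc p - (card (insert v V) * a) ^ Suc p"
      using insert.hyps by (simp add: algebra_simps)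
    finally show ?thesis by (simp add: Suc)
  qed
qed

text \<open>Since \<open>a \<le> x v\<close>, the \<open>q\<close>-subsets outside \<open>L\<close>
  would contribute nonnegative terms, so all of them may be added.\<close>

lemma sum_prod_diff_le:
  fixes x :: "'a \<Rightarrow> real" and a :: real
  assumes "finite V" "0 \<le> a" "\<And>v. v \<in> V \<Longrightarrow> a \<le> x v"
    and "\<And>S. S \<in> L \<Longrightarrow> S \<subseteq> V \<and> card S = q"
  shows "fact q * (\<Sum>S\<in>L. prod x S - a ^ q) \<le> sum x V ^ q - (card V * a) ^ q"
proof -
  have "(\<Sum>S\<in>L. prod x S - a ^ q) \<le> (\<Sum>S | S \<subseteq> V \<and> card S = q. prod x S - a ^ q)"
  proof (rule sum_mono2)
    fix S assume "S \<in> {S. S \<subseteq> V \<and> card S = q} - L"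
    then have "a ^ q = (\<Prod>v\<in>S. a)" "S \<subseteq> V" by auto
    then show "0 \<le> prod x S - a ^ q"
      using assms(2,3) prod_mono[of S "\<lambda>_. a" x] by (auto simp: subset_iff)
  qed (use assms in auto)
  then have "fact q * (\<Sum>S\<in>L. prod x S - a ^ q) \<le>
      fact q * (\<Sum>S | S \<subseteq> V \<and> card S = q. prod x S - a ^ q)"
    by simp
  also have "\<dots> \<le> sum x V ^ q - (card V * a) ^ q"
    using assms by (intro sum_subset_prod_diff_le) auto
  finally show ?thesis .
qed

lemma sum_prod_le_power_sum:
  fixes x :: "'a \<Rightarrow> real"
  assumes "finite V" "\<And>v. v \<in> V \<Longrightarrow> 0 \<le> x v"
    and "\<And>S. S \<in> L \<Longrightarrow> S \<subseteq> V \<and> card S = q"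
  shows "fact q * (\<Sum>S\<in>L. prod x S) \<le> sum x V ^ q"
proof (cases q)
  \<comment> \<open>Here \<open>0 ^ 0 = 1\<close>, so the comparison with \<open>a = 0\<close> used
    for positive \<open>q\<close> would be void.\<close>
  case 0
  have "L \<subseteq> {{}}"
    using assms by (auto simp: 0) (metis card_eq_0_iff empty_iff finite_subset)
  then have "L = {} \<or> L = {{}}" by auto
  then show ?thesis by (auto simp: 0)
next
  case (Suc p)
  have "fact q * (\<Sum>S\<in>L. prod x S - (0::real) ^ q) \<le> sum x V ^ q - (card V * (0::real)) ^ q"
    using assms by (intro sum_prod_diff_le) auto
  then show ?thesis by (simp add: Suc)
qed

section \<open>Optimal weights and the eigenvector equation\<close>

lemma r_graph_finite_verts: "r_graph r G \<Longrightarrow> finite (verts G)"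
  by (simp add: r_graph_def)

lemma r_graph_edge:
  assumes "r_graph r G" "e \<in> edges G"
  shows "e \<subseteq> verts G" "card e = r" "finite e"
  using assms finite_subset by (auto simp: r_graph_def)

lemma r_graph_finite_edges: "r_graph r G \<Longrightarrow> finite (edges G)"
  by (rule finite_subset[of _ "Pow (verts G)"]) (auto simp: r_graph_def)

text \<open>Up to the factor \<open>fact r\<close>, the partial derivative of the edge polynomial of
  an r-graph in the variable of \<open>v\<close>.\<close>

definition link_sum :: "hypergraph \<Rightarrow> nat \<Rightarrow> (nat \<Rightarrow> real) \<Rightarrow> real" where
  "link_sum G v y = (\<Sum>e | e \<in> edges G \<and> v \<in> e. prod y (e - {v}))"

definition del_vertex :: "nat \<Rightarrow> hypergraph \<Rightarrow> hypergraph" where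
  "del_vertex v G = (verts G - {v}, {e \<in> edges G. v \<notin> e})"

text \<open>For a new vertex \<open>w\<close> of an r-graph no edge contains both \<open>v\<close>
  and \<open>w\<close>, so the copy may share the colour of \<open>v\<close>.\<close>

definition clone_vertex :: "nat \<Rightarrow> nat \<Rightarrow> hypergraph \<Rightarrow> hypergraph" where
  "clone_vertex v w G =
     (insert w (verts G), edges G \<union> (\<lambda>e. insert w (e - {v})) ` {e \<in> edges G. v \<in> e})"

lemma verts_del_vertex [simp]: "verts (del_vertex v G) = verts G - {v}"
  by (simp add: del_vertex_def)

lemma verts_clone_vertex [simp]: "verts (clone_vertex v w G) = insert w (verts G)"
  by (simp add: clone_vertex_def)

lemma r_graph_del_vertex: "r_graph r G \<Longrightarrow> r_graph r (del_vertex v G)"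
  by (auto simp: r_graph_def del_vertex_def)

lemma card_insert_Diff_swap:
  assumes "finite e" "v \<in> e" "w \<notin> e"
  shows "card (insert w (e - {v})) = card e"
  using assms by (metis Diff_iff card.remove card_insert_disjoint finite_Diff)

lemma r_graph_clone_vertex:
  assumes "r_graph r G" "w \<notin> verts G"
  shows "r_graph r (clone_vertex v w G)"
  unfolding r_graph_def
proof (intro conjI ballI)
  show "finite (verts (clone_vertex v w G))"
    using r_graph_finite_verts[OF assms(1)] by simp
  fix e assume "e \<in> edges (clone_vertex v w G)"
  then consider "e \<in> edges G" | f where "f \<in> edges G" "v \<in> f" "e = insert w (f - {v})"
    by (auto simp: clone_vertex_def)
  then have "e \<subseteq> verts (clone_vertex v w G) \<and> card e = r"
  proof cases
    case 1
    then show ?thesis using r_graph_edge[OF assms(1)] by auto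
  next
    case 2
    note f = r_graph_edge[OF assms(1) 2(1)]
    then have "w \<notin> f" using assms(2) by auto
    then show ?thesis using f 2 card_insert_Diff_swap[of f v w] by auto
  qed
  then show "e \<subseteq> verts (clone_vertex v w G)" "card e = r" by auto
qed

lemma edge_poly_cong:
  assumes "r_graph r G" "\<And>v. v \<in> verts G \<Longrightarrow> x v = y v"
  shows "edge_poly r G x = edge_poly r G y"
  unfolding edge_poly_def using assms r_graph_edge(1)[OF assms(1)]
  by (intro arg_cong2[where f = "(*)"] refl sum.cong prod.cong) auto

lemma edge_poly_scale:
  assumes "r_graph r G"
  shows "edge_poly r G (\<lambda>v. c * y v) = c ^ r * edge_poly r G y"
proof -
  have "(\<Sum>e\<in>edges G. \<Prod>v\<in>e. c * y v) = (\<Sum>e\<in>edges G. c ^ r * (\<Prod>v\<in>e. y v))"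
    using r_graph_edge[OF assms] by (intro sum.cong) (auto simp: prod.distrib)
  then show ?thesis by (simp add: edge_poly_def sum_distrib_left mult_ac)
qed

lemma edge_poly_le_abs: "edge_poly r G x \<le> edge_poly r G (\<lambda>v. \<bar>x v\<bar>)"
  unfolding edge_poly_def
  by (intro mult_left_mono sum_mono) (auto simp flip: abs_prod)

lemma edge_poly_del_vertex_upd [simp]:
  "edge_poly r (del_vertex v G) (y(v := s)) = edge_poly r (del_vertex v G) y"
  unfolding edge_poly_def del_vertex_def
  by (intro arg_cong2[where f = "(*)"] refl sum.cong prod.cong) auto

lemma link_sum_upd [simp]: "link_sum G v (y(v := s)) = link_sum G v y"
  unfolding link_sum_def by (intro sum.cong prod.cong) auto

text \<open>The polynomial is linear in each variable, as edges are sets.\<close>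

lemma edge_poly_split:
  assumes "r_graph r G"
  shows "edge_poly r G y = edge_poly r (del_vertex v G) y + fact r * (y v * link_sum G v y)"
proof -
  have "(\<Sum>e\<in>edges G. prod y e) =
      (\<Sum>e | e \<in> edges G \<and> v \<notin> e. prod y e) + (\<Sum>e | e \<in> edges G \<and> v \<in> e. prod y e)"
    using r_graph_finite_edges[OF assms]
    by (subst sum.union_disjoint[symmetric]) (auto intro!: sum.cong)
  also have "(\<Sum>e | e \<in> edges G \<and> v \<in> e. prod y e) = y v * link_sum G v y"
    unfolding link_sum_def sum_distrib_left using r_graph_edge(3)[OF assms]
    by (intro sum.cong) (auto simp: prod.remove)
  finally show ?thesis by (simp add: edge_poly_def del_vertex_def algebra_simps)
qed

text \<open>With the weight of \<open>v\<close> on its copy, the edges through \<open>v\<close> are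
  counted twice.\<close>

lemma edge_poly_clone_vertex:
  assumes "r_graph r G" "w \<notin> verts G"
  shows "edge_poly r (clone_vertex v w G) (y(w := y v)) =
    edge_poly r G y + fact r * (y v * link_sum G v y)"
proof -
  let ?y = "y(w := y v)" and ?E = "{e \<in> edges G. v \<in> e}"
  note e = r_graph_edge[OF assms(1)]
  have nw: "w \<notin> e" if "e \<in> edges G" for e using e(1)[OF that] assms(2) by auto
  have inj: "inj_on (\<lambda>e. insert w (e - {v})) ?E"
  proof (rule inj_onI)
    fix e f assume ef: "e \<in> ?E" "f \<in> ?E" "insert w (e - {v}) = insert w (f - {v})"
    then have "e - {v} = f - {v}" using nw[of e] nw[of f] by auto
    then show "e = f" using ef by auto
  qed
  have "sum (prod ?y) (edges (clone_vertex v w G)) =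
      sum (prod ?y) (edges G) + sum (prod ?y) ((\<lambda>e. insert w (e - {v})) ` ?E)"
    unfolding clone_vertex_def snd_conv
    using r_graph_finite_edges[OF assms(1)] nw by (intro sum.union_disjoint) auto
  also have "sum (prod ?y) ((\<lambda>e. insert w (e - {v})) ` ?E) = y v * link_sum G v y"
    unfolding link_sum_def sum_distrib_left sum.reindex[OF inj] o_def
  proof (intro sum.cong refl)
    fix e assume e': "e \<in> ?E"
    then have "w \<notin> e" "finite e" using nw e by auto
    moreover have "prod ?y (e - {v}) = prod y (e - {v})"
      using \<open>w \<notin> e\<close> by (intro prod.cong) auto
    ultimately show "prod ?y (insert w (e - {v})) = y v * prod y (e - {v})" by simp
  qed
  also have "sum (prod ?y) (edges G) = sum (prod y) (edges G)"
    using nw by (intro sum.cong prod.cong) auto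
  finally show ?thesis by (simp add: edge_poly_def algebra_simps)
qed

text \<open>Rescaling the weights so that the constant weight 1 becomes admissible turns the maximum
  over the unit \<open>\<alpha>\<close>-sphere into the maximum over all weights with
  \<open>\<Sum>v. \<bar>y v\<bar> powr \<alpha> = card (verts G)\<close>.\<close>

definition scaled_radius :: "real \<Rightarrow> nat \<Rightarrow> hypergraph \<Rightarrow> real" where
  "scaled_radius \<alpha> r G = card (verts G) powr (r / \<alpha>) * spectral_radius \<alpha> r G"

definition optimal_weight :: "real \<Rightarrow> nat \<Rightarrow> hypergraph \<Rightarrow> (nat \<Rightarrow> real) \<Rightarrow> bool" where
  "optimal_weight \<alpha> r G y \<longleftrightarrow> (\<forall>v. y v \<ge> 0) \<and> (\<Sum>v\<in>verts G. y v powr \<alpha>) = card (verts G) \<and>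
     edge_poly r G y = scaled_radius \<alpha> r G"

text \<open>Homogeneity of degree \<open>r\<close>: dividing by \<open>N powr (1 / \<alpha>)\<close>
  places the weights on the unit sphere. Allowing arbitrary \<open>N\<close> lets vertices be
  deleted or cloned without renormalising the weights.\<close>

lemma edge_poly_le_scaled_radius:
  assumes "\<alpha> > 0" "r_graph r G" "(\<Sum>v\<in>verts G. \<bar>z v\<bar> powr \<alpha>) = N" "N > 0"
  shows "edge_poly r G z \<le> scaled_radius \<alpha> r G * (N / card (verts G)) powr (r / \<alpha>)"
proof -
  have ne: "verts G \<noteq> {}" using assms by auto
  then have k: "card (verts G) > 0" using r_graph_finite_verts[OF assms(2)] by (simp add: card_gt_0_iff)
  define c where "c = N powr (1 / \<alpha>)"
  have c: "c > 0" using assms by (simp add: c_def)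
  have "(\<Sum>v\<in>verts G. \<bar>z v / c\<bar> powr \<alpha>) = (\<Sum>v\<in>verts G. \<bar>z v\<bar> powr \<alpha> / N)"
    using c assms by (intro sum.cong) (auto simp: powr_divide c_def powr_powr)
  also have "\<dots> = 1" using assms by (simp flip: sum_divide_distrib)
  finally have "edge_poly r G (\<lambda>v. z v / c) \<le> spectral_radius \<alpha> r G"
    using spectral_radius_attained[OF assms(1,2) ne] by auto
  moreover have "edge_poly r G z = c ^ r * edge_poly r G (\<lambda>v. z v / c)"
    using c by (simp flip: edge_poly_scale[OF assms(2)])
  moreover have "c ^ r = N powr (r / \<alpha>)"
    using assms(4) by (simp add: c_def powr_powr flip: powr_realpow)
  ultimately have "edge_poly r G z \<le> N powr (r / \<alpha>) * spectral_radius \<alpha> r G"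
    by (simp add: mult_left_mono)
  also have "\<dots> = scaled_radius \<alpha> r G * (N / card (verts G)) powr (r / \<alpha>)"
    using k assms by (simp add: scaled_radius_def powr_divide)
  finally show ?thesis .
qed

lemma optimal_weight_exists:
  assumes "\<alpha> > 0" "r_graph r G" "verts G \<noteq> {}"
  obtains y where "optimal_weight \<alpha> r G y"
proof -
  from spectral_radius_attained[OF assms] obtain x where
    x: "(\<Sum>v\<in>verts G. \<bar>x v\<bar> powr \<alpha>) = 1" "spectral_radius \<alpha> r G = edge_poly r G x"
    and max: "\<And>y. (\<Sum>v\<in>verts G. \<bar>y v\<bar> powr \<alpha>) = 1 \<Longrightarrow> edge_poly r G y \<le> edge_poly r G x"
    by blast
  \<comment> \<open>Passing to absolute values keeps a maximiser, which makes the optimal weights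
    nonnegative.\<close>
  have abs: "edge_poly r G (\<lambda>v. \<bar>x v\<bar>) = edge_poly r G x"
    using max[of "\<lambda>v. \<bar>x v\<bar>"] x edge_poly_le_abs[of r G x] by simp
  define c where "c = real (card (verts G)) powr (1 / \<alpha>)"
  have k: "card (verts G) > 0"
    using assms r_graph_finite_verts by (simp add: card_gt_0_iff)
  have "c ^ r = card (verts G) powr (r / \<alpha>)"
    using k by (simp add: c_def powr_powr flip: powr_realpow)
  then have "edge_poly r G (\<lambda>v. c * \<bar>x v\<bar>) = scaled_radius \<alpha> r G"
    by (simp add: edge_poly_scale[OF assms(2)] abs scaled_radius_def x)
  moreover have "(\<Sum>v\<in>verts G. (c * \<bar>x v\<bar>) powr \<alpha>) = card (verts G)"
    using x(1) assms(1) k by (simp add: powr_mult c_def powr_powr flip: sum_distrib_left)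
  moreover have "c \<ge> 0" by (simp add: c_def)
  ultimately have "optimal_weight \<alpha> r G (\<lambda>v. c * \<bar>x v\<bar>)"
    by (simp add: optimal_weight_def)
  then show thesis by (rule that)
qed

lemma sum_powr_upd:
  assumes "finite V" "v \<in> V"
  shows "(\<Sum>u\<in>V. (y(v := s)) u powr p) = (\<Sum>u\<in>V. y u powr p) - y v powr p + (s::real) powr p"
proof -
  have "(\<Sum>u\<in>V. (y(v := s)) u powr p) = s powr p + (\<Sum>u\<in>V - {v}. y u powr p)"
    unfolding sum.remove[OF assms] by (intro arg_cong2[where f = "(+)"] sum.cong) auto
  then show ?thesis by (simp add: sum.remove[OF assms])
qed

text \<open>Multiplied by \<open>y v\<close>, the Lagrange condition holds at vanishing weights too.
  No multiplier is introduced: the homogeneous bound is an inequality in the single weight at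
  \<open>v\<close>, with equality at \<open>y v\<close>, so the derivative of the difference
  vanishes there.\<close>

lemma optimal_weight_eigen_equation:
  assumes "\<alpha> > 0" "r_graph r G" "optimal_weight \<alpha> r G y" "v \<in> verts G"
  shows "fact r * (y v * link_sum G v y) =
    r * scaled_radius \<alpha> r G * (y v powr \<alpha> / card (verts G))"
proof (cases "y v = 0")
  case False
  let ?k = "card (verts G)" and ?m = "scaled_radius \<alpha> r G"
  define B where "B = edge_poly r (del_vertex v G) y"
  define L where "L = link_sum G v y"
  define K where "K = ?k - y v powr \<alpha>"
  \<comment> \<open>The value of the polynomial when the weight at \<open>v\<close> becomes
    \<open>s\<close>, minus the upper bound for the resulting sum of powers; \<open>K\<close>
    collects the other vertices.\<close>
  define h where "h s = B + fact r * (s * L) - ?m * ((K + s powr \<alpha>) / ?k) powr (r / \<alpha>)" for s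
  have fin: "finite (verts G)" and y: "\<And>v. y v \<ge> 0"
    and sum: "(\<Sum>u\<in>verts G. y u powr \<alpha>) = ?k" and opt: "edge_poly r G y = ?m"
    using assms r_graph_finite_verts by (auto simp: optimal_weight_def)
  have pos: "y v > 0" using False y[of v] by simp
  have k: "?k > 0" using assms fin by (auto simp: card_gt_0_iff)
  have K: "K \<ge> 0" unfolding K_def sum[symmetric]
    using member_le_sum[OF assms(4), of "\<lambda>u. y u powr \<alpha>"] fin by simp
  have hle: "h s \<le> 0" if "s > 0" for s
  proof -
    have "(\<Sum>u\<in>verts G. \<bar>(y(v := s)) u\<bar> powr \<alpha>) = (\<Sum>u\<in>verts G. (y(v := s)) u powr \<alpha>)"
      using that y by (intro sum.cong) auto
    also have "\<dots> = K + s powr \<alpha>"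
      using sum_powr_upd[OF fin assms(4)] sum by (simp add: K_def)
    finally have "edge_poly r G (y(v := s)) \<le> ?m * ((K + s powr \<alpha>) / ?k) powr (r / \<alpha>)"
      using K that by (intro edge_poly_le_scaled_radius assms) (auto simp: add_nonneg_pos)
    then show ?thesis
      unfolding edge_poly_split[OF assms(2), of _ v] h_def B_def L_def by simp
  qed
  have h0: "h (y v) = 0"
    using k opt edge_poly_split[OF assms(2), of y v] by (simp add: h_def K_def B_def L_def)
  have "(h has_real_derivative (fact r * L - ?m * (r / \<alpha> * (\<alpha> * y v powr (\<alpha> - 1) / ?k)))) (at (y v))"
    unfolding h_def
    by (rule derivative_eq_intros refl | use pos k K in \<open>simp add: K_def\<close>)+
  \<comment> \<open>Within distance \<open>y v\<close> the weight stays positive, where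
    \<open>h\<close> is at most \<open>0 = h (y v)\<close>.\<close>
  moreover have "h z \<le> h (y v)" if "\<bar>y v - z\<bar> < y v" for z
    using hle[of z] h0 that by auto
  ultimately have "fact r * L - ?m * (r / \<alpha> * (\<alpha> * y v powr (\<alpha> - 1) / ?k)) = 0"
    using DERIV_local_max[OF _ pos] by blast
  then have "fact r * L = r * ?m * (y v powr (\<alpha> - 1) / ?k)"
    using assms(1) by simp
  then have "y v * (fact r * L) = y v * (r * ?m * (y v powr (\<alpha> - 1) / ?k))"
    by simp
  moreover have "y v powr \<alpha> = y v * y v powr (\<alpha> - 1)"
    using pos by (simp add: powr_mult_base)
  ultimately show ?thesis by (simp add: L_def mult_ac)
qed simp

section \<open>Deleting and cloning vertices\<close>

text \<open>Here \<open>k\<close> is the order, \<open>t\<close> the share of the deleted vertex in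
  the sum of the \<alpha>-th powers and \<open>s = r / \<alpha>\<close>. The polynomial keeps a
  share of \<open>1 - r * t\<close>, renormalising yields the power, and the binomial coefficient
  shrinks by \<open>1 - r / k\<close>. To first order the gain is at least
  \<open>(r - p) * (1 / k - t)\<close>; half of it survives the error terms once \<open>k\<close> is
  large.\<close>

lemma deletion_estimate:
  fixes r s t k :: real
  defines "p \<equiv> max s 1"
  assumes "s > 0" "p < r" "k \<ge> 2" "k > r" "2 * p * r + r + p \<le> k * (r - p)" "0 \<le> t" "t \<le> 1 / k"
  shows "(1 - r / k) * (1 + (r - p) / 2 * (1 / k - t)) \<le> (1 - r * t) * ((k - 1) / (k * (1 - t))) powr s"
proof -
  define \<delta> where "\<delta> = 1 / k - t"
  define q where "q = k / (k - 1)"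
  have p: "p \<ge> 1" "r > 1" using assms by auto
  have d: "0 \<le> \<delta>" "\<delta> \<le> 1 / k" using assms by (auto simp: \<delta>_def)
  have q: "q > 0" using assms by (auto simp: q_def)
  have k1: "1 / k \<le> 1 / 2" using assms by (simp add: field_simps)
  then have t1: "t \<le> 1 / 2" using assms by linarith
  have y: "(k - 1) / (k * (1 - t)) = 1 - \<delta> / (1 - t)"
    using t1 assms by (simp add: \<delta>_def divide_simps) (simp add: algebra_simps)
  have yq: "\<delta> / (1 - t) \<le> \<delta> * q"
  proof -
    have "1 / q \<le> 1 - t" using assms by (simp add: q_def diff_divide_distrib)
    then have "1 / (1 - t) \<le> q" using q t1 by (simp add: field_simps)
    then show ?thesis using d mult_left_mono[of "1 / (1 - t)" q \<delta>] by simp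
  qed
  have "\<delta> / (1 - t) \<le> 1" using d k1 t1 by simp
  then have "1 - p * (\<delta> / (1 - t)) \<le> (1 - \<delta> / (1 - t)) powr s"
    unfolding p_def using d t1 assms(2) by (intro one_minus_powr_ge) auto
  then have powr_ge: "1 - p * (\<delta> * q) \<le> ((k - 1) / (k * (1 - t))) powr s"
    unfolding y using yq p mult_left_mono[OF yq, of p] by linarith
  have rk: "0 \<le> 1 - r / k" "1 - r / k \<le> 1" using assms p by (auto simp: field_simps)
  have "q * (1 + r * \<delta>) \<le> q * (1 + r / k)"
    using q d p mult_left_mono[of \<delta> "1 / k" r] by (intro mult_left_mono) auto
  also have "\<dots> = (k + r) / (k - 1)" using assms by (simp add: q_def field_simps)
  finally have "p * (q * (1 + r * \<delta>)) \<le> p * ((k + r) / (k - 1))"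
    using p by (intro mult_left_mono) auto
  \<comment> \<open>After clearing denominators this is exactly the hypothesis bounding
    \<open>k * (r - p)\<close> from below.\<close>
  also have "\<dots> \<le> (r + p) / 2"
    using assms(4,6) by (simp add: field_simps)
  finally have "\<delta> * ((r - p) / 2) \<le> \<delta> * (r - p * (q * (1 + r * \<delta>)))"
    using d by (intro mult_left_mono) (auto simp: field_simps)
  then have core: "1 + (r - p) / 2 * \<delta> \<le> (1 + r * \<delta>) * (1 - p * (\<delta> * q))"
    by (simp add: algebra_simps)
  have "(1 - r / k) * (1 + (r - p) / 2 * \<delta>) \<le> (1 - r / k) * ((1 + r * \<delta>) * (1 - p * (\<delta> * q)))"
    using core rk by (intro mult_left_mono) auto
  also have "\<dots> \<le> (1 - r / k) * ((1 + r * \<delta>) * ((k - 1) / (k * (1 - t))) powr s)"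
    using rk p d powr_ge by (intro mult_left_mono) auto
  also have "\<dots> = ((1 - r / k) * (1 + r * \<delta>)) * ((k - 1) / (k * (1 - t))) powr s"
    by simp
  also have "\<dots> \<le> (1 - r * t) * ((k - 1) / (k * (1 - t))) powr s"
  proof (rule mult_right_mono)
    have "(1 - r / k) * (r * \<delta>) \<le> 1 * (r * \<delta>)"
      using rk p d by (intro mult_right_mono) auto
    then show "(1 - r / k) * (1 + r * \<delta>) \<le> 1 - r * t"
      by (simp add: \<delta>_def algebra_simps)
  qed simp
  finally show ?thesis by (simp add: \<delta>_def)
qed

text \<open>The counterpart for a vertex of share \<open>t\<close> at least \<open>1 / m\<close>:
  for \<open>t = 1 / m\<close> both sides agree, and the excess over \<open>1 / m\<close> can only
  help once \<open>m\<close> is large compared with \<open>C\<close>.\<close>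

lemma cloning_estimate:
  fixes r s t m C :: real
  defines "p \<equiv> max s 1"
  assumes "s > 0" "p < r" "m \<ge> 1" "p * r * (1 + C) \<le> m * (r - p)" "1 / m \<le> t" "t \<le> C / m"
  shows "1 + r / m \<le> (1 + r * t) * ((m + 1) / (m * (1 + t))) powr s"
proof -
  define \<tau> where "\<tau> = t - 1 / m"
  have p: "p \<ge> 1" "r > 1" using assms by auto
  have m0: "0 < 1 / m" using assms by simp
  have t0: "t > 0" using m0 assms by linarith
  have \<tau>: "0 \<le> \<tau>" "\<tau> \<le> t" "\<tau> \<le> C / m" using assms(4,6,7) by (auto simp: \<tau>_def intro: order_trans[of _ t])
  have y: "(m + 1) / (m * (1 + t)) = 1 - \<tau> / (1 + t)"
    using t0 assms by (simp add: \<tau>_def divide_simps) (simp add: algebra_simps)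
  have yt: "\<tau> / (1 + t) \<le> \<tau>" using \<tau> t0 by (simp add: divide_le_eq mult_le_cancel_left1)
  have "\<tau> / (1 + t) \<le> 1" using \<tau> t0 by simp
  then have "1 - p * (\<tau> / (1 + t)) \<le> (1 - \<tau> / (1 + t)) powr s"
    unfolding p_def using \<tau> t0 assms(2) by (intro one_minus_powr_ge) auto
  then have powr_ge: "1 - p * \<tau> \<le> ((m + 1) / (m * (1 + t))) powr s"
    unfolding y using p mult_left_mono[OF yt, of p] by linarith
  have "p * r * (1 / m + \<tau>) \<le> p * r * ((1 + C) / m)"
    using \<tau> p by (intro mult_left_mono) (auto simp: add_divide_distrib)
  also have "\<dots> \<le> r - p" using assms by (simp add: field_simps)
  finally have "\<tau> * (p * r * (1 / m + \<tau>)) \<le> \<tau> * (r - p)"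
    using \<tau> by (intro mult_left_mono)
  then have "1 + r / m \<le> (1 + r * t) * (1 - p * \<tau>)"
    by (simp add: \<tau>_def diff_divide_distrib algebra_simps)
  also have "\<dots> \<le> (1 + r * t) * ((m + 1) / (m * (1 + t))) powr s"
    using powr_ge t0 p by (intro mult_left_mono) auto
  finally show ?thesis .
qed

section \<open>Change of the density under deletion and cloning\<close>

definition radius_density :: "real \<Rightarrow> nat \<Rightarrow> hypergraph \<Rightarrow> real" where
  "radius_density \<alpha> r G = scaled_radius \<alpha> r G / (fact r * real (card (verts G) choose r))"

lemma scaled_radius_eq_density:
  assumes "r \<le> card (verts G)"
  shows "scaled_radius \<alpha> r G = radius_density \<alpha> r G * (fact r * real (card (verts G) choose r))"
  using assms by (simp add: radius_density_def)

lemma choose_pred: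
  assumes "k \<ge> 1"
  shows "real (k - 1 choose r) = real (k choose r) * (1 - r / k)"
proof (cases "r \<le> k")
  case True
  obtain n where n: "k = Suc n" using assms by (cases k) auto
  have "(k - r) * (k choose r) = k * (k - 1 choose r)"
    using binomial_absorb_comp[of k r] by simp
  then have "real (k - r) * real (k choose r) = k * real (k - 1 choose r)"
    by (metis of_nat_mult)
  then show ?thesis using True assms by (simp add: of_nat_diff field_simps)
qed (use assms in \<open>simp add: binomial_eq_0\<close>)

lemma fact_choose_ge:
  assumes "r \<le> k"
  shows "fact r * real (k choose r) \<ge> real (k - r) ^ r"
proof -
  have "fact r * real (k choose r) = (\<Prod>i = 0..<r. real k - real i)"
    by (simp add: binomial_gbinomial gbinomial_prod_rev)
  also have "\<dots> \<ge> (\<Prod>i = 0..<r. real (k - r))"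
    using assms by (intro prod_mono) (auto simp: of_nat_diff)
  finally show ?thesis by simp
qed

lemma optimal_weight_sum_le:
  assumes "\<alpha> \<ge> 1" "r_graph r G" "optimal_weight \<alpha> r G y"
  shows "sum y (verts G) \<le> card (verts G)"
  using assms r_graph_finite_verts
  by (intro sum_le_card_if_sum_powr_eq_card[of \<alpha>]) (auto simp: optimal_weight_def)

text \<open>The old optimal weights are tested on the smaller graph. By the eigenvector equation the
  edges through \<open>v\<close> carry a share \<open>r * t\<close> of the polynomial,
  \<open>t\<close> being the share of \<open>v\<close> in the sum of powers, so
  \<open>deletion_estimate\<close> applies.\<close>

lemma radius_density_del_vertex:
  fixes \<alpha> p :: real and r k :: nat and G :: hypergraph
  defines "p \<equiv> max (r / \<alpha>) 1" and "k \<equiv> card (verts G)"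
  assumes "\<alpha> > 1" "r \<ge> 2" "r_graph r G" "optimal_weight \<alpha> r G y" "v \<in> verts G"
    and "y v \<le> 1" "k > r" "2 * p * r + r + p \<le> k * (r - p)" "radius_density \<alpha> r G \<ge> 0"
  shows "radius_density \<alpha> r G * (1 + (r - p) / 2 * ((1 - y v powr \<alpha>) / k))
    \<le> radius_density \<alpha> r (del_vertex v G)"
proof -
  let ?m = "scaled_radius \<alpha> r G" and ?m' = "scaled_radius \<alpha> r (del_vertex v G)"
  define t where "t = y v powr \<alpha> / k"
  have pr: "p < r" using assms by (auto simp: p_def divide_less_eq)
  have y: "\<And>v. y v \<ge> 0" and sum: "(\<Sum>u\<in>verts G. y u powr \<alpha>) = k" and opt: "edge_poly r G y = ?m"
    using assms by (auto simp: optimal_weight_def)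
  have fin: "finite (verts G)" using assms r_graph_finite_verts by auto
  have kr: "real k > r" "k \<ge> 2" using assms by auto
  have c: "real (k choose r) > 0" using assms by (simp add: zero_less_binomial_iff)
  have m0: "?m \<ge> 0"
    using scaled_radius_eq_density[of r G \<alpha>] assms by simp
  have "y v powr \<alpha> \<le> 1" using assms y[of v] by (simp add: powr_le1)
  then have t: "0 \<le> t" "t \<le> 1 / k" using kr by (auto simp: t_def divide_right_mono)
  have "1 / real k < 1" using kr by simp
  then have t1: "t < 1" using t by linarith
  have ck: "card (verts (del_vertex v G)) = k - 1" using fin assms by simp
  have "(\<Sum>u\<in>verts (del_vertex v G). \<bar>y u\<bar> powr \<alpha>) = k * (1 - t)"
    using sum fin assms(7) kr y by (simp add: sum_diff1 t_def algebra_simps)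
  then have "edge_poly r (del_vertex v G) y \<le> ?m' * (k * (1 - t) / (real k - 1)) powr (r / \<alpha>)"
    using edge_poly_le_scaled_radius[of \<alpha> r "del_vertex v G" y "k * (1 - t)"]
      assms r_graph_del_vertex t1 kr ck by (auto simp: of_nat_diff)
  moreover have "edge_poly r (del_vertex v G) y = ?m * (1 - r * t)"
    using edge_poly_split[OF assms(5), of y v] opt optimal_weight_eigen_equation[OF _ assms(5,6,7)]
      assms(3) by (simp add: t_def k_def algebra_simps)
  ultimately have le: "?m * (1 - r * t) \<le> ?m' * (k * (1 - t) / (real k - 1)) powr (r / \<alpha>)"
    by simp
  have inv: "(k * (1 - t) / (real k - 1)) powr (r / \<alpha>) * ((real k - 1) / (k * (1 - t))) powr (r / \<alpha>) = 1"
    using kr t1 by (simp add: powr_mult[symmetric])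
  have "?m * ((1 - r / k) * (1 + (r - p) / 2 * (1 / k - t)))
    \<le> ?m * ((1 - r * t) * ((real k - 1) / (k * (1 - t))) powr (r / \<alpha>))"
  proof (rule mult_left_mono[OF _ m0])
    show "(1 - r / k) * (1 + (r - p) / 2 * (1 / k - t))
        \<le> (1 - r * t) * ((real k - 1) / (k * (1 - t))) powr (r / \<alpha>)"
      unfolding p_def using kr t assms(3,4,10) pr
      by (intro deletion_estimate) (auto simp: p_def)
  qed
  also have "\<dots> = (?m * (1 - r * t)) * ((real k - 1) / (k * (1 - t))) powr (r / \<alpha>)" by simp
  also have "\<dots> \<le> (?m' * (k * (1 - t) / (real k - 1)) powr (r / \<alpha>)) * ((real k - 1) / (k * (1 - t))) powr (r / \<alpha>)"
    by (rule mult_right_mono[OF le]) simp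
  also have "\<dots> = ?m'" using inv by (simp only: mult.assoc mult_1_right)
  finally have main: "?m * ((1 - r / k) * (1 + (r - p) / 2 * (1 / k - t))) \<le> ?m'" .
  have rk: "1 - r / k > 0" using kr by simp
  have d: "radius_density \<alpha> r (del_vertex v G) = ?m' / (fact r * (real (k choose r) * (1 - r / k)))"
    unfolding radius_density_def ck using choose_pred[of k r] kr by simp
  have eq: "M / (F * A) * X = M * (R * X) / (F * (A * R))" if "R \<noteq> 0" for M F A R X :: real
    using that by simp
  have "radius_density \<alpha> r G * (1 + (r - p) / 2 * (1 / k - t))
      = ?m * ((1 - r / k) * (1 + (r - p) / 2 * (1 / k - t))) / (fact r * (real (k choose r) * (1 - r / k)))"
    unfolding radius_density_def k_def[symmetric] by (rule eq) (rule less_imp_neq[OF rk, symmetric])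
  also have "\<dots> \<le> radius_density \<alpha> r (del_vertex v G)"
    unfolding d using c rk by (intro divide_right_mono main) auto
  finally show ?thesis by (simp add: t_def diff_divide_distrib)
qed

text \<open>With \<open>k\<close> the order, the link sum is at most
  \<open>k ^ (r - 1) / fact (r - 1)\<close>, whereas by the eigenvector equation it grows like
  \<open>y v powr (\<alpha> - 1)\<close>; as \<open>\<alpha> > 1\<close>, this caps the
  weight.\<close>

lemma optimal_weight_bound:
  assumes "\<alpha> > 1" "r \<ge> 1" "r_graph r G" "optimal_weight \<alpha> r G y" "v \<in> verts G"
    and "scaled_radius \<alpha> r G > 0"
  shows "y v powr \<alpha> \<le> (card (verts G) ^ r / scaled_radius \<alpha> r G) powr (\<alpha> / (\<alpha> - 1))"
proof (cases "y v = 0")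
  case False
  let ?m = "scaled_radius \<alpha> r G" and ?k = "card (verts G)"
  let ?E = "{e \<in> edges G. v \<in> e}"
  have y: "\<And>v. y v \<ge> 0" using assms by (auto simp: optimal_weight_def)
  then have pos: "y v > 0" using False by (simp add: less_le)
  have fin: "finite (verts G)" using assms r_graph_finite_verts by auto
  then have k: "?k > 0" using assms by (auto simp: card_gt_0_iff)
  obtain q where q: "r = Suc q" using assms(2) by (cases r) auto
  have inj: "inj_on (\<lambda>e. e - {v}) ?E" by (rule inj_onI) auto
  have "fact q * (\<Sum>S\<in>(\<lambda>e. e - {v}) ` ?E. prod y S) \<le> sum y (verts G) ^ q"
    using fin y r_graph_edge[OF assms(3)] by (intro sum_prod_le_power_sum) (auto simp: q)
  also have "(\<Sum>S\<in>(\<lambda>e. e - {v}) ` ?E. prod y S) = link_sum G v y"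
    unfolding link_sum_def by (simp add: sum.reindex[OF inj])
  also have "sum y (verts G) ^ q \<le> real ?k ^ q"
    using optimal_weight_sum_le[OF _ assms(3,4)] assms(1) y by (intro power_mono sum_nonneg) auto
  finally have link: "fact q * link_sum G v y \<le> real ?k ^ q" .
  have "r * ?m * (y v powr \<alpha> / ?k) = r * y v * (fact q * link_sum G v y)"
    using optimal_weight_eigen_equation[OF _ assms(3-5)] assms(1) by (simp add: q mult_ac)
  also have "\<dots> \<le> r * y v * real ?k ^ q"
    using link pos by (intro mult_left_mono) auto
  finally have "r * (?m * (y v powr \<alpha> / ?k)) \<le> r * (y v * real ?k ^ q)" by (simp add: mult_ac)
  then have "?m * (y v powr \<alpha> / ?k) \<le> y v * real ?k ^ q"
    using assms(2) by (subst (asm) mult_le_cancel_left_pos) auto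
  then have "?m * y v powr \<alpha> \<le> y v * real ?k ^ r" using k by (simp add: q field_simps)
  moreover have "y v powr \<alpha> = y v * y v powr (\<alpha> - 1)" using pos by (simp add: powr_mult_base)
  ultimately have "y v * (?m * y v powr (\<alpha> - 1)) \<le> y v * real ?k ^ r" by (simp add: mult_ac)
  then have "?m * y v powr (\<alpha> - 1) \<le> real ?k ^ r" using pos by simp
  then have "y v powr (\<alpha> - 1) \<le> ?k ^ r / ?m" using assms(6) by (simp add: field_simps)
  then have "(y v powr (\<alpha> - 1)) powr (\<alpha> / (\<alpha> - 1)) \<le> (?k ^ r / ?m) powr (\<alpha> / (\<alpha> - 1))"
    using assms(1) by (intro powr_mono2) auto
  then show ?thesis using assms(1) by (simp add: powr_powr)
qed simp

text \<open>The \<alpha>-th powers of the weights have average 1.\<close>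

lemma optimal_weight_max_vertex:
  assumes "r_graph r G" "verts G \<noteq> {}" "optimal_weight \<alpha> r G y"
  obtains v where "v \<in> verts G" "y v powr \<alpha> \<ge> 1"
proof -
  have fin: "finite (verts G)" using assms r_graph_finite_verts by auto
  have "\<exists>v\<in>verts G. y v powr \<alpha> \<ge> 1"
  proof (rule ccontr)
    assume "\<not> ?thesis"
    then have "(\<Sum>v\<in>verts G. y v powr \<alpha>) < (\<Sum>v\<in>verts G. 1)"
      using fin assms by (intro sum_strict_mono) auto
    then show False using assms by (simp add: optimal_weight_def)
  qed
  then show thesis using that by auto
qed

text \<open>The copy receives the weight of \<open>v\<close>. The factor equals
  \<open>1 - r * (r - 1) / (m * (m + 1))\<close>, so the loss is only of order
  \<open>1 / m ^ 2\<close>.\<close>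

lemma radius_density_clone_vertex:
  fixes \<alpha> C p :: real and r m :: nat and G :: hypergraph
  defines "p \<equiv> max (r / \<alpha>) 1" and "m \<equiv> card (verts G)"
  assumes "\<alpha> > 1" "r \<ge> 2" "r_graph r G" "optimal_weight \<alpha> r G y" "v \<in> verts G" "w \<notin> verts G"
    and "1 \<le> y v powr \<alpha>" "y v powr \<alpha> \<le> C" "m > r" "p * r * (1 + C) \<le> m * (r - p)"
    and "radius_density \<alpha> r G \<ge> 0"
  shows "radius_density \<alpha> r G * ((1 + r / m) * (1 - r / (m + 1)))
    \<le> radius_density \<alpha> r (clone_vertex v w G)"
proof -
  let ?m = "scaled_radius \<alpha> r G" and ?m' = "scaled_radius \<alpha> r (clone_vertex v w G)"
  define t where "t = y v powr \<alpha> / m"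
  have pr: "p < r" using assms by (auto simp: p_def divide_less_eq)
  have y: "\<And>v. y v \<ge> 0" and sum: "(\<Sum>u\<in>verts G. y u powr \<alpha>) = m" and opt: "edge_poly r G y = ?m"
    using assms by (auto simp: optimal_weight_def)
  have fin: "finite (verts G)" using assms r_graph_finite_verts by auto
  have mr: "real m > r" "m \<ge> 2" using assms by auto
  have c: "real (m choose r) > 0" using assms by (simp add: zero_less_binomial_iff)
  have m0: "?m \<ge> 0"
    using scaled_radius_eq_density[of r G \<alpha>] assms by simp
  have t: "1 / m \<le> t" "t \<le> C / m" using assms mr by (auto simp: t_def divide_right_mono)
  have t0: "t \<ge> 0" by (simp add: t_def)
  have cm: "card (verts (clone_vertex v w G)) = m + 1" using fin assms by simp
  have "(\<Sum>u\<in>insert w (verts G). \<bar>(y(w := y v)) u\<bar> powr \<alpha>) = y v powr \<alpha> + (\<Sum>u\<in>verts G. y u powr \<alpha>)"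
    using fin assms(8) y by (subst sum.insert) (auto intro!: sum.cong)
  then have "(\<Sum>u\<in>verts (clone_vertex v w G). \<bar>(y(w := y v)) u\<bar> powr \<alpha>) = m * (1 + t)"
    using mr by (simp add: sum t_def algebra_simps)
  then have "edge_poly r (clone_vertex v w G) (y(w := y v))
      \<le> ?m' * (m * (1 + t) / (m + 1)) powr (r / \<alpha>)"
    using edge_poly_le_scaled_radius[of \<alpha> r "clone_vertex v w G" "y(w := y v)" "m * (1 + t)"]
      assms r_graph_clone_vertex t0 mr unfolding cm by auto
  moreover have "edge_poly r (clone_vertex v w G) (y(w := y v)) = ?m * (1 + r * t)"
    unfolding edge_poly_clone_vertex[OF assms(5,8)] opt
    using optimal_weight_eigen_equation[OF _ assms(5,6,7)] assms(3)
    by (simp add: t_def m_def algebra_simps)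
  ultimately have le: "?m * (1 + r * t) \<le> ?m' * (m * (1 + t) / (m + 1)) powr (r / \<alpha>)"
    by simp
  have inv: "(m * (1 + t) / (m + 1)) powr (r / \<alpha>) * ((m + 1) / (m * (1 + t))) powr (r / \<alpha>) = 1"
    using mr t0 by (simp add: powr_mult[symmetric])
  have "?m * (1 + r / m) \<le> ?m * ((1 + r * t) * ((m + 1) / (m * (1 + t))) powr (r / \<alpha>))"
    using m0 mr t assms pr cloning_estimate[of "r / \<alpha>" r m C t]
    by (intro mult_left_mono) (auto simp: p_def add.commute)
  also have "\<dots> = (?m * (1 + r * t)) * ((m + 1) / (m * (1 + t))) powr (r / \<alpha>)" by simp
  also have "\<dots> \<le> (?m' * (m * (1 + t) / (m + 1)) powr (r / \<alpha>)) * ((m + 1) / (m * (1 + t))) powr (r / \<alpha>)"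
    by (rule mult_right_mono[OF le]) simp
  also have "\<dots> = ?m'" using inv by (simp only: mult.assoc mult_1_right)
  finally have main: "?m * (1 + r / m) \<le> ?m'" .
  have rm: "1 - r / (m + 1) > 0" using mr by simp
  have c': "real (m choose r) = real (m + 1 choose r) * (1 - r / (m + 1))"
    using choose_pred[of "m + 1" r] by simp
  have eq: "M / (F * (A * R)) * (B * R) = M * B / (F * A)" if "R \<noteq> 0" for M F A R B :: real
    using that by simp
  have "radius_density \<alpha> r G * ((1 + r / m) * (1 - r / (m + 1)))
      = ?m * (1 + r / m) / (fact r * real (m + 1 choose r))"
    unfolding radius_density_def c' m_def[symmetric] by (rule eq) (use rm in simp)
  also have "\<dots> \<le> ?m' / (fact r * real (m + 1 choose r))"
    using main by (intro divide_right_mono) auto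
  finally show ?thesis unfolding radius_density_def cm .
qed

text \<open>The eigenvector equation bounds the link sum from below. Each of its products is at
  least \<open>b ^ (r - 1)\<close>, and with \<open>k\<close> the order their total excess over this
  value is at most \<open>(1 - b ^ (r - 1)) * k ^ (r - 1) / fact (r - 1)\<close>, so a large link
  sum forces many edges.\<close>

lemma degree_ge_of_flat_optimal_weight:
  assumes "\<alpha> > 1" "r \<ge> 1" "r_graph r G" "optimal_weight \<alpha> r G y" "v \<in> verts G"
    and "\<And>u. u \<in> verts G \<Longrightarrow> b \<le> y u" "0 < (b::real)" "b \<le> 1"
    and "scaled_radius \<alpha> r G \<ge> (c::real) * card (verts G) ^ r" "c \<ge> 0"
  shows "fact (r - 1) * real (vertex_degree G v) \<ge>
    (c * b powr (\<alpha> - 1) - (1 - b ^ (r - 1))) * card (verts G) ^ (r - 1)"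
proof -
  let ?m = "scaled_radius \<alpha> r G" and ?k = "card (verts G)"
  let ?E = "{e \<in> edges G. v \<in> e}"
  have y: "\<And>v. y v \<ge> 0" using assms by (auto simp: optimal_weight_def)
  have pos: "y v > 0" using assms(5-7) by fastforce
  have fin: "finite (verts G)" using assms r_graph_finite_verts by auto
  then have k: "?k > 0" using assms by (auto simp: card_gt_0_iff)
  obtain q where q: "r = Suc q" using assms(2) by (cases r) auto
  have inj: "inj_on (\<lambda>e. e - {v}) ?E" by (rule inj_onI) auto
  \<comment> \<open>Bounding the excess of the whole sum avoids an upper bound on single weights,
    which may be far above 1.\<close>
  have "fact q * (\<Sum>S\<in>(\<lambda>e. e - {v}) ` ?E. prod y S - b ^ q) \<le> sum y (verts G) ^ q - (?k * b) ^ q"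
    using fin assms r_graph_edge[OF assms(3)] by (intro sum_prod_diff_le) (auto simp: q)
  also have "(\<Sum>S\<in>(\<lambda>e. e - {v}) ` ?E. prod y S - b ^ q) = link_sum G v y - vertex_degree G v * b ^ q"
    unfolding link_sum_def vertex_degree_def sum.reindex[OF inj] by (simp add: sum_subtractf)
  also have "sum y (verts G) ^ q \<le> real ?k ^ q"
    using optimal_weight_sum_le[OF _ assms(3,4)] assms(1) y by (intro power_mono sum_nonneg) auto
  finally have "fact q * link_sum G v y - fact q * real (vertex_degree G v) * b ^ q \<le> (1 - b ^ q) * real ?k ^ q"
    by (simp add: power_mult_distrib algebra_simps)
  moreover have "fact q * real (vertex_degree G v) * b ^ q \<le> fact q * real (vertex_degree G v) * 1"
    using assms by (intro mult_left_mono power_le_one) auto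
  moreover have m0: "0 \<le> ?m" by (rule order_trans[OF _ assms(9)]) (use assms(10) in simp)
  have "fact q * link_sum G v y \<ge> c * b powr (\<alpha> - 1) * real ?k ^ q"
  proof -
    have "c * b powr (\<alpha> - 1) * real ?k ^ q = (c * real ?k ^ r) * (b powr (\<alpha> - 1) / ?k)"
      using k by (simp add: q)
    also have "\<dots> \<le> ?m * (y v powr (\<alpha> - 1) / ?k)"
      using assms k m0 by (intro mult_mono divide_right_mono powr_mono2) auto
    also have "\<dots> = fact q * link_sum G v y"
    proof -
      have "y v powr \<alpha> = y v * y v powr (\<alpha> - 1)" using pos by (simp add: powr_mult_base)
      then have "r * y v * (?m * (y v powr (\<alpha> - 1) / ?k)) = r * y v * (fact q * link_sum G v y)"
        using optimal_weight_eigen_equation[OF _ assms(3-5)] assms(1) by (simp add: q mult_ac)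
      then show ?thesis by (subst (asm) mult_left_cancel) (use pos q in auto)
    qed
    finally show ?thesis .
  qed
  ultimately have "c * b powr (\<alpha> - 1) * real ?k ^ q - (1 - b ^ q) * real ?k ^ q
    \<le> fact q * real (vertex_degree G v)"
    by linarith
  then show ?thesis by (simp add: q left_diff_distrib)
qed

section \<open>Colorable graphs and the Turan density\<close>

lemma family_free_del_vertex:
  assumes "family_free \<F> G" shows "family_free \<F> (del_vertex v G)"
proof -
  have "subgraph H G" if "subgraph H (del_vertex v G)" for H
    using that by (auto simp: subgraph_def del_vertex_def)
  then show ?thesis using assms by (auto simp: family_free_def)
qed

lemma Col_del_vertex:
  assumes "G \<in> Col r P" shows "del_vertex v G \<in> Col r P"
  using assms r_graph_del_vertex unfolding Col_def colorable_def del_vertex_def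
  by (auto simp: image_subset_iff)

text \<open>Giving the copy the colour of \<open>v\<close> leaves the colour multiset of every
  exchanged edge unchanged.\<close>

lemma Col_clone_vertex:
  assumes "G \<in> Col r P" "v \<in> verts G" "w \<notin> verts G"
  shows "clone_vertex v w G \<in> Col r P"
proof -
  have G: "r_graph r G" using assms by (simp add: Col_def)
  obtain \<phi> where \<phi>: "\<phi> ` verts G \<subseteq> {1..fst P}"
      "\<And>e. e \<in> edges G \<Longrightarrow> image_mset \<phi> (mset_set e) \<in> snd P"
    using assms(1) unfolding Col_def colorable_def by auto
  define \<psi> where "\<psi> = \<phi>(w := \<phi> v)"
  have old: "image_mset \<psi> (mset_set e) = image_mset \<phi> (mset_set e)" if "w \<notin> e" "finite e" for e
    using that by (intro image_mset_cong) (auto simp: \<psi>_def)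
  have nw: "w \<notin> e" if "e \<in> edges G" for e using r_graph_edge(1)[OF G that] assms(3) by auto
  have "image_mset \<psi> (mset_set e) \<in> snd P" if e: "e \<in> edges (clone_vertex v w G)" for e
  proof -
    consider "e \<in> edges G" | f where "f \<in> edges G" "v \<in> f" "e = insert w (f - {v})"
      using e by (auto simp: clone_vertex_def)
    then show ?thesis
    proof cases
      case 1
      then show ?thesis using old nw \<phi>(2) r_graph_edge(3)[OF G] by simp
    next
      case 2
      then have f: "finite f" "w \<notin> f" using nw r_graph_edge(3)[OF G] by auto
      have "mset_set f = add_mset v (mset_set (f - {v}))"
        using f 2 by (metis mset_set.remove)
      then have "image_mset \<psi> (mset_set e) = image_mset \<phi> (mset_set f)"
        using f 2 old[of "f - {v}"] by (simp add: \<psi>_def)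
      then show ?thesis using \<phi>(2) 2 by simp
    qed
  qed
  moreover have "\<psi> ` verts (clone_vertex v w G) \<subseteq> {1..fst P}"
    using \<phi>(1) assms by (auto simp: \<psi>_def image_subset_iff)
  ultimately show ?thesis
    using r_graph_clone_vertex[OF G assms(3)] unfolding Col_def colorable_def by blast
qed

text \<open>Under degree stability this supplies free graphs of every order.\<close>

lemma empty_graph_Col:
  assumes "is_pattern r P" "finite V"
  shows "(V, {}) \<in> Col r P"
proof -
  have "(\<lambda>_. 1) ` V \<subseteq> {1..fst P}" using assms(1) by (auto simp: is_pattern_def)
  then show ?thesis using assms(2) by (auto simp: Col_def colorable_def r_graph_def)
qed

section \<open>Invariance under isomorphism and the maximum over \<open>Col r P\<close>\<close>

lemma spectral_radius_map:
  fixes f :: "nat \<Rightarrow> nat"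
  assumes "r_graph r G" "inj_on f (verts G)"
  shows "spectral_radius \<alpha> r (f ` verts G, (`) f ` edges G) = spectral_radius \<alpha> r G"
proof -
  let ?H = "(f ` verts G, (`) f ` edges G)"
  note e = r_graph_edge[OF assms(1)]
  have inj: "inj_on f e" if "e \<in> edges G" for e using inj_on_subset[OF assms(2) e(1)[OF that]] .
  have injE: "inj_on ((`) f) (edges G)"
    using inj_on_image_Pow[OF assms(2)] by (rule inj_on_subset) (use e in auto)
  have poly: "edge_poly r ?H x = edge_poly r G (x \<circ> f)" for x
    unfolding edge_poly_def using inj by (auto simp: sum.reindex[OF injE] prod.reindex intro!: sum.cong)
  have norm: "(\<Sum>v\<in>verts ?H. \<bar>x v\<bar> powr \<alpha>) = (\<Sum>v\<in>verts G. \<bar>(x \<circ> f) v\<bar> powr \<alpha>)" for x :: "nat \<Rightarrow> real"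
    by (simp add: sum.reindex[OF assms(2)])
  have "{edge_poly r ?H x | x. (\<Sum>v\<in>verts ?H. \<bar>x v\<bar> powr \<alpha>) = 1} =
    {edge_poly r G x | x. (\<Sum>v\<in>verts G. \<bar>x v\<bar> powr \<alpha>) = 1}" (is "?L = ?R")
  proof
    show "?L \<subseteq> ?R" unfolding poly norm by blast
    show "?R \<subseteq> ?L"
    proof
      fix a assume "a \<in> ?R"
      then obtain x where x: "a = edge_poly r G x" "(\<Sum>v\<in>verts G. \<bar>x v\<bar> powr \<alpha>) = 1" by blast
      \<comment> \<open>A weighting of \<open>G\<close> is transported along the inverse of
        \<open>f\<close>; only its values on the image matter.\<close>
      define z where "z = x \<circ> inv_into (verts G) f"
      have z: "(z \<circ> f) v = x v" if "v \<in> verts G" for v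
        using that assms(2) by (simp add: z_def)
      have "edge_poly r ?H z = a" unfolding poly x(1) by (rule edge_poly_cong[OF assms(1) z])
      moreover have "(\<Sum>v\<in>verts ?H. \<bar>z v\<bar> powr \<alpha>) = 1"
        unfolding norm x(2)[symmetric] by (intro sum.cong) (auto simp: z[unfolded o_def])
      ultimately show "a \<in> ?L" by blast
    qed
  qed
  then show ?thesis by (simp add: spectral_radius_def)
qed

text \<open>Vertex sets range over all \<open>n\<close>-sets of natural numbers, yet every graph is
  isomorphic to one on \<open>{..<n}\<close>. Finiteness makes the \<open>Max\<close> in
  \<open>family_spectral_radius\<close> an upper bound.\<close>

lemma finite_spectral_radii:
  "finite {spectral_radius \<alpha> r H | H. r_graph r H \<and> card (verts H) = n}"
proof (rule finite_subset)
  show "finite (spectral_radius \<alpha> r ` ({{..<n}} \<times> Pow (Pow {..<n})))" by simp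
  show "{spectral_radius \<alpha> r H | H. r_graph r H \<and> card (verts H) = n}
      \<subseteq> spectral_radius \<alpha> r ` ({{..<n}} \<times> Pow (Pow {..<n}))"
  proof clarify
    fix V E assume H: "r_graph r (V, E)" "n = card (verts (V, E))"
    then have "finite V" by (simp add: r_graph_def)
    then obtain f where f: "bij_betw f V {..<n}"
      using H by (metis bij_betw_iff_card card_lessThan finite_lessThan fst_conv)
    then have inj: "inj_on f (verts (V, E))" and im: "f ` V = {..<n}" by (auto simp: bij_betw_def)
    have "(`) f ` E \<subseteq> Pow {..<n}" using H(1) im by (auto simp: r_graph_def)
    then have "({..<n}, (`) f ` E) \<in> {{..<n}} \<times> Pow (Pow {..<n})" by simp
    moreover have "spectral_radius \<alpha> r (V, E) = spectral_radius \<alpha> r ({..<n}, (`) f ` E)"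
      using spectral_radius_map[OF H(1) inj, of \<alpha>] im by simp
    ultimately show "spectral_radius \<alpha> r (V, E) \<in> spectral_radius \<alpha> r ` ({{..<card (verts (V, E))}} \<times> Pow (Pow {..<card (verts (V, E))}))"
      unfolding H(2) by blast
  qed
qed

lemma spectral_radius_le_family:
  assumes "H \<in> Col r P" "card (verts H) = n"
  shows "spectral_radius \<alpha> r H \<le> family_spectral_radius \<alpha> r (Col r P) n"
  unfolding family_spectral_radius_def
proof (rule Max_ge)
  show "finite {spectral_radius \<alpha> r H | H. H \<in> Col r P \<and> card (verts H) = n}"
    by (rule finite_subset[OF _ finite_spectral_radii[of \<alpha> r n]]) (auto simp: Col_def)
qed (use assms in blast)

section \<open>Averaging of degrees and the Turan number\<close>

lemma sum_vertex_degree: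
  assumes "r_graph r G"
  shows "(\<Sum>v\<in>verts G. vertex_degree G v) = r * card (edges G)"
proof -
  have fin: "finite (verts G)" "finite (edges G)"
    using assms r_graph_finite_verts r_graph_finite_edges by auto
  have "(\<Sum>v\<in>verts G. vertex_degree G v) = (\<Sum>v\<in>verts G. \<Sum>e | e \<in> edges G \<and> v \<in> e. 1)"
    by (simp add: vertex_degree_def)
  also have "\<dots> = (\<Sum>e\<in>edges G. \<Sum>v | v \<in> verts G \<and> v \<in> e. 1)"
    by (rule sum.swap_restrict[OF fin])
  also have "\<dots> = (\<Sum>e\<in>edges G. r)"
  proof (rule sum.cong[OF refl])
    fix e assume "e \<in> edges G"
    then have "{v. v \<in> verts G \<and> v \<in> e} = e" "card e = r" using r_graph_edge[OF assms] by auto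
    then show "(\<Sum>v | v \<in> verts G \<and> v \<in> e. 1) = r" by simp
  qed
  finally show ?thesis by simp
qed

text \<open>A vertex of at most average degree is deleted.\<close>

lemma del_vertex_edges_ge:
  assumes "r_graph r G" "verts G \<noteq> {}"
  obtains v where "v \<in> verts G"
    "card (edges G) * (1 - r / card (verts G)) \<le> real (card (edges (del_vertex v G)))"
proof -
  let ?k = "card (verts G)" and ?e = "card (edges G)"
  have fin: "finite (verts G)" "finite (edges G)"
    using assms r_graph_finite_verts r_graph_finite_edges by auto
  have k: "?k > 0" using assms fin by (simp add: card_gt_0_iff)
  have "\<exists>v\<in>verts G. real (vertex_degree G v) \<le> r * ?e / ?k"
  proof (rule ccontr)
    assume "\<not> ?thesis"
    then have "(\<Sum>v\<in>verts G. r * ?e / ?k) < (\<Sum>v\<in>verts G. real (vertex_degree G v))"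
      using fin assms by (intro sum_strict_mono) auto
    also have "\<dots> = r * ?e" using sum_vertex_degree[OF assms(1)] by (metis of_nat_sum)
    finally show False using k by simp
  qed
  then obtain v where v: "v \<in> verts G" "real (vertex_degree G v) \<le> r * ?e / ?k" by blast
  have "?e = card (edges (del_vertex v G)) + vertex_degree G v"
    unfolding del_vertex_def vertex_degree_def snd_conv using fin(2)
    by (subst card_Un_disjoint[symmetric]) (auto intro!: arg_cong[of _ _ card])
  then have "real ?e = card (edges (del_vertex v G)) + real (vertex_degree G v)"
    by (metis of_nat_add)
  then have "card (edges G) * (1 - r / card (verts G)) \<le> real (card (edges (del_vertex v G)))"
    using v(2) by (simp only: right_diff_distrib) (simp add: mult.commute)
  then show thesis by (rule that[OF v(1)])
qed

lemma turan_number_finite: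
  "finite {card (edges G) | G. r_graph r G \<and> card (verts G) = n \<and> family_free \<F> G}"
proof (rule finite_subset)
  show "{card (edges G) | G. r_graph r G \<and> card (verts G) = n \<and> family_free \<F> G} \<subseteq> {..2 ^ n}"
  proof
    fix x assume "x \<in> {card (edges G) | G. r_graph r G \<and> card (verts G) = n \<and> family_free \<F> G}"
    then obtain G where G: "x = card (edges G)" "r_graph r G" "card (verts G) = n" by blast
    have "finite (verts G)" using r_graph_finite_verts[OF G(2)] .
    then have "card (edges G) \<le> card (Pow (verts G))"
      using r_graph_edge(1)[OF G(2)] by (intro card_mono) auto
    then show "x \<in> {..2 ^ n}" using G \<open>finite (verts G)\<close> by (simp add: card_Pow)
  qed
qed simp

lemma turan_number_ge:
  assumes "r_graph r G" "family_free \<F> G"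
  shows "card (edges G) \<le> turan_number r (card (verts G)) \<F>"
  unfolding turan_number_def using assms by (intro Max_ge turan_number_finite) blast

lemma turan_number_attained:
  assumes "r_graph r G\<^sub>0" "card (verts G\<^sub>0) = n" "family_free \<F> G\<^sub>0"
  obtains G where "r_graph r G" "card (verts G) = n" "family_free \<F> G" "card (edges G) = turan_number r n \<F>"
proof -
  have "turan_number r n \<F> \<in> {card (edges G) | G. r_graph r G \<and> card (verts G) = n \<and> family_free \<F> G}"
    unfolding turan_number_def using assms by (intro Max_in turan_number_finite) blast
  then show thesis using that by auto
qed

text \<open>The averaging argument of Katona, Nemetz and Simonovits. It is also what shows that the limit
  defining the Turan density exists.\<close>

lemma turan_density_le:
  assumes "\<And>n. \<exists>G. r_graph r G \<and> card (verts G) = n \<and> family_free \<F> G" "n \<ge> r"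
  shows "turan_density r \<F> \<le> turan_number r n \<F> / (n choose r)"
proof -
  define X where "X n = real (turan_number r n \<F>) / real (n choose r)" for n
  have "X (Suc n) \<le> X n" if "n \<ge> r" for n
  proof -
    obtain G where G: "r_graph r G" "card (verts G) = Suc n" "family_free \<F> G"
      "card (edges G) = turan_number r (Suc n) \<F>"
      using assms(1)[of "Suc n"] turan_number_attained by metis
    have "verts G \<noteq> {}" using G(2) by auto
    then obtain v where v: "v \<in> verts G"
      "card (edges G) * (1 - r / Suc n) \<le> real (card (edges (del_vertex v G)))"
      using del_vertex_edges_ge[OF G(1)] G(2) by metis
    have cv: "card (verts (del_vertex v G)) = n" using v G r_graph_finite_verts[OF G(1)] by simp
    have "card (edges (del_vertex v G)) \<le> turan_number r (card (verts (del_vertex v G))) \<F>"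
      by (intro turan_number_ge r_graph_del_vertex family_free_del_vertex G)
    then have "real (card (edges (del_vertex v G))) \<le> turan_number r n \<F>"
      by (simp only: cv of_nat_le_iff)
    then have le: "turan_number r (Suc n) \<F> * (1 - r / Suc n) \<le> turan_number r n \<F>"
      using v G by simp
    have c: "real (n choose r) = real (Suc n choose r) * (1 - r / Suc n)"
      using choose_pred[of "Suc n" r] by simp
    have pos: "1 - r / Suc n > 0" "real (Suc n choose r) > 0"
      using that by (auto simp: zero_less_binomial_iff)
    have eq: "T / A = T * R / (A * R)" if "R \<noteq> 0" for T A R :: real using that by simp
    have "X (Suc n) = turan_number r (Suc n) \<F> * (1 - r / Suc n) / (n choose r)"
      unfolding X_def c by (rule eq) (rule less_imp_neq[OF pos(1), symmetric])
    also have "\<dots> \<le> X n" unfolding X_def using le by (intro divide_right_mono) auto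
    finally show ?thesis .
  qed
  \<comment> \<open>The sequence is shifted by \<open>r\<close> because \<open>n choose r\<close>
    vanishes for \<open>n < r\<close>, where the quotient takes the default value 0.\<close>
  then have dec: "decseq (\<lambda>n. X (n + r))" by (intro decseq_SucI) auto
  moreover have "\<And>n. 0 \<le> X (n + r)" by (simp add: X_def)
  ultimately obtain L where L: "(\<lambda>n. X (n + r)) \<longlonglongrightarrow> L" "\<And>n. L \<le> X (n + r)"
    using decseq_convergent[of "\<lambda>n. X (n + r)" 0] by metis
  have "turan_density r \<F> = L"
    using limI[OF LIMSEQ_offset[OF L(1)]] by (simp add: turan_density_def X_def)
  then show ?thesis using L(2)[of "n - r"] assms(2) by (simp add: X_def)
qed

text \<open>The constant weight 1 serves as a test vector.\<close>

lemma edge_density_le_radius_density: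
  assumes "\<alpha> > 0" "r_graph r G" "verts G \<noteq> {}"
  shows "card (edges G) / (card (verts G) choose r) \<le> radius_density \<alpha> r G"
proof -
  have k: "card (verts G) > 0" using assms r_graph_finite_verts by (simp add: card_gt_0_iff)
  have "edge_poly r G (\<lambda>_. 1) \<le> scaled_radius \<alpha> r G * (real (card (verts G)) / card (verts G)) powr (r / \<alpha>)"
    using assms k by (intro edge_poly_le_scaled_radius) auto
  then have "fact r * card (edges G) \<le> scaled_radius \<alpha> r G"
    using k by (simp add: edge_poly_def)
  then have "fact r * card (edges G) / (fact r * real (card (verts G) choose r)) \<le> radius_density \<alpha> r G"
    unfolding radius_density_def by (intro divide_right_mono) auto
  then show ?thesis by simp
qed

text \<open>A bound that depends on the order alone; it limits the density that repeated deletion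
  can build up.\<close>

lemma radius_density_le:
  assumes "\<alpha> \<ge> 1" "r_graph r G" "verts G \<noteq> {}"
  shows "radius_density \<alpha> r G \<le> card (verts G) ^ r / (fact r * (card (verts G) choose r))"
proof -
  obtain y where y: "optimal_weight \<alpha> r G y" using optimal_weight_exists[of \<alpha> r G] assms by auto
  have "scaled_radius \<alpha> r G = fact r * (\<Sum>e\<in>edges G. prod y e)"
    using y by (simp add: optimal_weight_def edge_poly_def)
  also have "\<dots> \<le> sum y (verts G) ^ r"
    using y r_graph_edge[OF assms(2)] r_graph_finite_verts[OF assms(2)]
    by (intro sum_prod_le_power_sum) (auto simp: optimal_weight_def)
  also have "\<dots> \<le> card (verts G) ^ r"
    using optimal_weight_sum_le[OF assms(1,2) y] y
    by (auto intro!: power_mono sum_nonneg simp: optimal_weight_def)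
  finally show ?thesis unfolding radius_density_def by (auto intro!: divide_right_mono)
qed

section \<open>Reduction to colorable graphs\<close>

text \<open>Turns the conditions that an order be large compared with constants into
  thresholds.\<close>

lemma ex_linear_bound:
  assumes "(d::real) > 0"
  shows "\<exists>K::nat. \<forall>k\<ge>K. X \<le> real k * d"
proof -
  obtain K :: nat where "X < real K * d" using reals_Archimedean3[OF assms] by blast
  moreover have "real K * d \<le> real k * d" if "k \<ge> K" for k using assms that by simp
  ultimately show ?thesis by fastforce
qed

locale stable_family =
  fixes \<alpha> :: real and r :: nat and P :: pattern and \<F> :: "hypergraph set"
  assumes alpha: "\<alpha> > 1" and r: "r \<ge> 2" and pattern: "is_pattern r P"
    and stable: "degree_stable r \<F> (Col r P)"
begin

abbreviation "\<tau> \<equiv> turan_density r \<F>"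
abbreviation "dens \<equiv> radius_density \<alpha> r"
text \<open>The constant in Bernoulli's inequality for the exponent \<open>r / \<alpha>\<close>;
  \<open>r - slope\<close> governs the rate of gain.\<close>

abbreviation "slope \<equiv> max (r / \<alpha>) 1"

lemma tau_pos: "\<tau> > 0"
  using stable by (simp add: degree_stable_def)

lemma Col_r_graph: "H \<in> Col r P \<Longrightarrow> r_graph r H"
  by (simp add: Col_def)

lemma Col_family_free: "H \<in> Col r P \<Longrightarrow> family_free \<F> H"
  using stable by (simp add: degree_stable_def)

text \<open>This is where \<open>\<alpha> > 1\<close> and \<open>r \<ge> 2\<close> give deletion a
  positive first-order gain.\<close>

lemma slope_less: "slope < r"
  using alpha r by (auto simp: divide_less_eq)

lemma scaled_radius_ge:
  assumes "card (verts G) > r" "\<tau> \<le> dens G"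
  shows "\<tau> * real (card (verts G) - r) ^ r \<le> scaled_radius \<alpha> r G"
proof -
  have "\<tau> * real (card (verts G) - r) ^ r \<le> dens G * (fact r * real (card (verts G) choose r))"
    using assms tau_pos fact_choose_ge[of r "card (verts G)"] by (intro mult_mono) auto
  then show ?thesis using scaled_radius_eq_density[of r G \<alpha>] assms by simp
qed

text \<open>As \<open>b\<close> tends to 1, the degree bound for weights at least \<open>b\<close>
  tends to the one given by the Turan density, so some fixed \<open>b < 1\<close> already reaches
  the threshold of degree stability.\<close>

lemma flat_imp_Col:
  "\<exists>b K. 0 < b \<and> b < 1 \<and> (\<forall>G y. r_graph r G \<and> family_free \<F> G \<and> card (verts G) \<ge> K \<and> \<tau> \<le> dens G \<and>
     optimal_weight \<alpha> r G y \<and> (\<forall>v\<in>verts G. b \<le> y v) \<longrightarrow> G \<in> Col r P)"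
proof -
  obtain n\<^sub>0 :: nat and \<epsilon> :: real where eps: "\<epsilon> > 0" and st: "\<And>n H. n \<ge> n\<^sub>0 \<Longrightarrow> r_graph r H \<Longrightarrow>
      card (verts H) = n \<Longrightarrow> family_free \<F> H \<Longrightarrow>
      real (min_degree H) \<ge> (\<tau> / fact (r - 1) - \<epsilon>) * real n ^ (r - 1) \<Longrightarrow> H \<in> Col r P"
    using stable unfolding degree_stable_def by blast
  \<comment> \<open>The coefficient in \<open>degree_ge_of_flat_optimal_weight\<close> for
    \<open>c = \<tau> * b\<close>; the extra factor \<open>b\<close> pays for replacing
    \<open>(k - r) ^ r\<close> by \<open>k ^ r\<close> at large order \<open>k\<close>.\<close>
  define h where "h b = \<tau> * b * b powr (\<alpha> - 1) - (1 - b ^ (r - 1))" for b :: real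
  have "(h \<longlongrightarrow> \<tau>) (at_left 1)"
    unfolding h_def by (rule tendsto_eq_intros refl | simp)+
  then have "\<forall>\<^sub>F b in at_left 1. \<tau> - \<epsilon> < h b"
    using eps by (intro order_tendstoD(1)) auto
  moreover have "\<forall>\<^sub>F b in at_left (1::real). b \<in> {0<..<1}"
    by (rule eventually_at_left_real) simp
  ultimately have "\<forall>\<^sub>F b in at_left 1. \<tau> - \<epsilon> < h b \<and> b \<in> {0<..<1}"
    by (rule eventually_conj)
  then obtain b where b: "\<tau> - \<epsilon> < h b" "0 < b" "b < 1"
    using eventually_happens'[OF trivial_limit_at_left_real] by fastforce
  have "(\<lambda>k. (1 - real r / real k) ^ r) \<longlonglongrightarrow> (1 - 0) ^ r"
    by (intro tendsto_intros lim_const_over_n)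
  then have "\<forall>\<^sub>F k in sequentially. b < (1 - real r / real k) ^ r"
    using b by (intro order_tendstoD(1)) auto
  then obtain K\<^sub>1 where K1: "\<And>k. k \<ge> K\<^sub>1 \<Longrightarrow> b < (1 - real r / real k) ^ r"
    unfolding eventually_sequentially by blast
  have "G \<in> Col r P" if G: "r_graph r G" "family_free \<F> G" "card (verts G) \<ge> max n\<^sub>0 (max K\<^sub>1 (Suc r))"
      "\<tau> \<le> dens G" and y: "optimal_weight \<alpha> r G y" "\<And>v. v \<in> verts G \<Longrightarrow> b \<le> y v" for G y
  proof -
    define k where "k = card (verts G)"
    have k: "k \<ge> n\<^sub>0" "k \<ge> K\<^sub>1" "k > r" using G(3) by (auto simp: k_def)
    have fin: "finite (verts G)" "verts G \<noteq> {}" using k r_graph_finite_verts[OF G(1)] by (auto simp: k_def)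
    have "b * real k ^ r \<le> (1 - real r / real k) ^ r * real k ^ r"
      using K1[OF k(2)] by (intro mult_right_mono) auto
    also have "\<dots> = real (k - r) ^ r"
      using k by (simp add: of_nat_diff left_diff_distrib flip: power_mult_distrib)
    finally have "\<tau> * b * real k ^ r \<le> \<tau> * real (k - r) ^ r"
      using tau_pos by (simp add: mult.assoc)
    also have "\<dots> \<le> scaled_radius \<alpha> r G"
      using scaled_radius_ge[OF _ G(4)] k by (simp add: k_def)
    finally have sr: "\<tau> * b * real k ^ r \<le> scaled_radius \<alpha> r G" .
    have "min_degree G \<in> vertex_degree G ` verts G"
      unfolding min_degree_def using fin by (intro Min_in) auto
    then obtain v where v: "v \<in> verts G" "min_degree G = vertex_degree G v" by auto
    have "(\<tau> * b * b powr (\<alpha> - 1) - (1 - b ^ (r - 1))) * real k ^ (r - 1)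
        \<le> fact (r - 1) * real (vertex_degree G v)"
      using degree_ge_of_flat_optimal_weight[of \<alpha> r G y v b "\<tau> * b"] alpha r G y v b sr tau_pos
      by (simp add: k_def)
    then have "(\<tau> - \<epsilon>) * real k ^ (r - 1) \<le> fact (r - 1) * real (min_degree G)"
      using mult_right_mono[of "\<tau> - \<epsilon>" "h b" "real k ^ (r - 1)"] b by (simp add: h_def v)
    then have "(\<tau> - \<epsilon>) / fact (r - 1) * real k ^ (r - 1) \<le> real (min_degree G)"
      by (simp add: field_simps)
    \<comment> \<open>Degree stability subtracts \<epsilon> after the division by
      \<open>fact (r - 1)\<close>, which is the weaker demand.\<close>
    moreover have "\<epsilon> / fact (r - 1) \<le> \<epsilon>"
      using eps fact_ge_1[of "r - 1", where 'a = real] by (simp add: divide_le_eq)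
    then have "(\<tau> / fact (r - 1) - \<epsilon>) * real k ^ (r - 1) \<le> (\<tau> - \<epsilon>) / fact (r - 1) * real k ^ (r - 1)"
      by (intro mult_right_mono) (auto simp: diff_divide_distrib)
    ultimately show ?thesis using st[OF k(1) G(1) k_def[symmetric] G(2)] by linarith
  qed
  then show ?thesis using b by blast
qed

text \<open>By \<open>flat_imp_Col\<close> a graph that is not colorable has a vertex of weight
  below \<open>b\<close>; the gain from deleting it is bounded below in terms of
  \<open>b\<close>.\<close>

lemma deletion_step:
  "\<exists>c K. c > 0 \<and> (\<forall>G. r_graph r G \<and> family_free \<F> G \<and> card (verts G) \<ge> K \<and> \<tau> \<le> dens G \<and> G \<notin> Col r P \<longrightarrow>
     (\<exists>v\<in>verts G. dens G * (1 + c / card (verts G)) \<le> dens (del_vertex v G)))"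
proof -
  obtain b K\<^sub>1 where b: "0 < b" "b < 1" and K1: "\<And>G y. r_graph r G \<Longrightarrow> family_free \<F> G \<Longrightarrow>
      card (verts G) \<ge> K\<^sub>1 \<Longrightarrow> \<tau> \<le> dens G \<Longrightarrow> optimal_weight \<alpha> r G y \<Longrightarrow>
      (\<forall>v\<in>verts G. b \<le> y v) \<Longrightarrow> G \<in> Col r P"
    using flat_imp_Col by blast
  obtain K\<^sub>2 where K2: "\<And>k. k \<ge> K\<^sub>2 \<Longrightarrow> 2 * slope * r + r + slope \<le> real k * (r - slope)"
    using ex_linear_bound[of "r - slope"] slope_less by auto
  define c where "c = (r - slope) / 2 * (1 - b powr \<alpha>)"
  have "b powr \<alpha> < 1" using powr_less_mono2[of \<alpha> b 1] b alpha by simp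
  then have c: "c > 0" using slope_less by (simp add: c_def)
  have "\<exists>v\<in>verts G. dens G * (1 + c / card (verts G)) \<le> dens (del_vertex v G)"
    if G: "r_graph r G" "family_free \<F> G" "card (verts G) \<ge> max K\<^sub>1 (max K\<^sub>2 (Suc r))"
      "\<tau> \<le> dens G" "G \<notin> Col r P" for G
  proof -
    let ?k = "card (verts G)"
    have "verts G \<noteq> {}" using G(3) by auto
    then obtain y where y: "optimal_weight \<alpha> r G y"
      using optimal_weight_exists[of \<alpha> r G] alpha G(1) by auto
    have "\<not> (\<forall>v\<in>verts G. b \<le> y v)"
      using K1[OF G(1,2) _ G(4) y] G(3,5) by auto
    then obtain v where v: "v \<in> verts G" "y v < b" by force
    have yv: "y v \<ge> 0" using y by (simp add: optimal_weight_def)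
    have d0: "dens G \<ge> 0" using G tau_pos by linarith
    have "y v powr \<alpha> \<le> b powr \<alpha>" using v yv alpha by (intro powr_mono2) auto
    then have "c / ?k \<le> (r - slope) / 2 * ((1 - y v powr \<alpha>) / ?k)"
      unfolding c_def times_divide_eq_right using slope_less
      by (intro divide_right_mono mult_left_mono) auto
    then have "dens G * (1 + c / ?k) \<le> dens G * (1 + (r - slope) / 2 * ((1 - y v powr \<alpha>) / ?k))"
      using d0 by (intro mult_left_mono) auto
    also have "\<dots> \<le> dens (del_vertex v G)"
      using alpha r G y v b K2[of ?k] d0 by (intro radius_density_del_vertex) auto
    finally show ?thesis using v by blast
  qed
  then show ?thesis using c by blast
qed

text \<open>A colorable graph may lack a light vertex, but the average weight is at most 1, so some
  vertex can be deleted without loss of density. This later adjusts the order to a prescribed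
  value.\<close>

lemma Col_deletion_step:
  "\<exists>K. \<forall>G\<in>Col r P. card (verts G) \<ge> K \<and> \<tau> \<le> dens G \<longrightarrow>
     (\<exists>v\<in>verts G. \<tau> \<le> dens (del_vertex v G))"
proof -
  obtain K where K: "\<And>k. k \<ge> K \<Longrightarrow> 2 * slope * r + r + slope \<le> real k * (r - slope)"
    using ex_linear_bound[of "r - slope"] slope_less by auto
  have "\<exists>v\<in>verts G. \<tau> \<le> dens (del_vertex v G)"
    if G: "G \<in> Col r P" "card (verts G) \<ge> max K (Suc r)" "\<tau> \<le> dens G" for G
  proof -
    let ?k = "card (verts G)"
    have rG: "r_graph r G" using Col_r_graph[OF G(1)] .
    have ne: "verts G \<noteq> {}" using G(2) by auto
    then obtain y where y: "optimal_weight \<alpha> r G y"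
      using optimal_weight_exists[of \<alpha> r G] alpha rG by auto
    have y0: "y v \<ge> 0" for v using y by (simp add: optimal_weight_def)
    have "\<exists>v\<in>verts G. y v \<le> 1"
    proof (rule ccontr)
      assume "\<not> ?thesis"
      then have "(\<Sum>v\<in>verts G. 1) < sum y (verts G)"
        using r_graph_finite_verts[OF rG] ne by (intro sum_strict_mono) auto
      then show False using optimal_weight_sum_le[OF _ rG y] alpha by simp
    qed
    then obtain v where v: "v \<in> verts G" "y v \<le> 1" by blast
    have d0: "dens G \<ge> 0" using G tau_pos by linarith
    have "y v powr \<alpha> \<le> 1" using v y0[of v] alpha by (simp add: powr_le1)
    then have "0 \<le> (r - slope) / 2 * ((1 - y v powr \<alpha>) / ?k)"
      using slope_less by (intro mult_nonneg_nonneg divide_nonneg_nonneg) auto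
    then have "dens G * 1 \<le> dens G * (1 + (r - slope) / 2 * ((1 - y v powr \<alpha>) / ?k))"
      using d0 by (intro mult_left_mono) auto
    also have "\<dots> \<le> dens (del_vertex v G)"
      using alpha r G rG y v K[of ?k] d0 by (intro radius_density_del_vertex) auto
    finally have "\<tau> \<le> dens (del_vertex v G)" using G(3) by linarith
    then show ?thesis using v(1) by blast
  qed
  then show ?thesis by blast
qed

text \<open>A vertex whose weight is at least 1 is cloned; a density of at least \<tau> bounds its
  weight independently of the graph.\<close>

lemma Col_cloning_step:
  "\<exists>K. \<forall>H\<in>Col r P. card (verts H) \<ge> K \<and> \<tau> \<le> dens H \<longrightarrow>
     (\<exists>H'\<in>Col r P. card (verts H') = Suc (card (verts H)) \<and>
        dens H * ((1 + r / card (verts H)) * (1 - r / (card (verts H) + 1))) \<le> dens H')"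
proof -
  \<comment> \<open>The cap of \<open>optimal_weight_bound\<close>: an order \<open>m\<close> of at
    least \<open>2 * r\<close> gives \<open>m - r \<ge> m / 2\<close>, so the scaled radius is at
    least \<open>\<tau> * (m / 2) ^ r\<close>.\<close>
  define C where "C = (2 ^ r / \<tau>) powr (\<alpha> / (\<alpha> - 1))"
  obtain K where K: "\<And>k. k \<ge> K \<Longrightarrow> slope * r * (1 + C) \<le> real k * (r - slope)"
    using ex_linear_bound[of "r - slope"] slope_less by auto
  have "\<exists>H'\<in>Col r P. card (verts H') = Suc (card (verts H)) \<and>
        dens H * ((1 + r / card (verts H)) * (1 - r / (card (verts H) + 1))) \<le> dens H'"
    if H: "H \<in> Col r P" "card (verts H) \<ge> max K (2 * r)" "\<tau> \<le> dens H" for H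
  proof -
    let ?m = "card (verts H)" and ?s = "scaled_radius \<alpha> r H"
    have rH: "r_graph r H" using Col_r_graph[OF H(1)] .
    have fin: "finite (verts H)" using r_graph_finite_verts[OF rH] .
    have m: "?m \<ge> 2 * r" "?m > r" using H(2) r by auto
    then have ne: "verts H \<noteq> {}" by auto
    then obtain y where y: "optimal_weight \<alpha> r H y"
      using optimal_weight_exists[of \<alpha> r H] alpha rH by auto
    obtain v where v: "v \<in> verts H" "y v powr \<alpha> \<ge> 1"
      using optimal_weight_max_vertex[OF rH ne y] by blast
    obtain w where w: "w \<notin> verts H" using ex_new_if_finite[OF infinite_UNIV_nat fin] by blast
    have "(real ?m / 2) ^ r \<le> real (?m - r) ^ r"
      using m by (intro power_mono) (auto simp: of_nat_diff)
    then have "\<tau> * (real ?m / 2) ^ r \<le> ?s"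
      using scaled_radius_ge[OF m(2) H(3)] tau_pos by (meson mult_left_mono less_imp_le order_trans)
    moreover have pos: "\<tau> * (real ?m / 2) ^ r > 0" using tau_pos m by (intro mult_pos_pos) auto
    ultimately have s: "?s > 0" "?m ^ r / ?s \<le> ?m ^ r / (\<tau> * (real ?m / 2) ^ r)"
      by (linarith, intro divide_left_mono) auto
    have "?m ^ r / (\<tau> * (real ?m / 2) ^ r) = 2 ^ r / \<tau>"
      using m tau_pos by (simp add: power_divide)
    then have "(?m ^ r / ?s) powr (\<alpha> / (\<alpha> - 1)) \<le> C"
      unfolding C_def using s alpha by (intro powr_mono2) auto
    then have yC: "y v powr \<alpha> \<le> C"
      using optimal_weight_bound[OF alpha _ rH y v(1) s(1)] r by linarith
    have "dens H * ((1 + r / ?m) * (1 - r / (?m + 1))) \<le> dens (clone_vertex v w H)"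
      using alpha r rH y v w yC m K[of ?m] H tau_pos
      by (intro radius_density_clone_vertex[where C = C and y = y]) auto
    moreover have "card (verts (clone_vertex v w H)) = Suc ?m" using fin w by simp
    ultimately show ?thesis using Col_clone_vertex[OF H(1) v(1) w] by blast
  qed
  then show ?thesis by blast
qed

section \<open>Comparison with the colorable graphs of equal order\<close>

definition beats :: "hypergraph \<Rightarrow> bool" where
  "beats G \<longleftrightarrow> (\<forall>H\<in>Col r P. card (verts H) = card (verts G) \<longrightarrow> dens H \<le> dens G)"

text \<open>No member of \<open>Col r P\<close> has this property, since it would have to exceed its
  own density.\<close>

definition strictly_beats :: "hypergraph \<Rightarrow> bool" where
  "strictly_beats G \<longleftrightarrow> (\<forall>H\<in>Col r P. card (verts H) = card (verts G) \<longrightarrow> dens H < dens G)"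

text \<open>Passing from \<open>m\<close> to \<open>m + 1\<close> vertices the best density in \<open>Col r P\<close> drops by a factor of at
  most \<open>1 - O(1/m\<^sup>2)\<close>, whereas deleting a light vertex gains a factor of \<open>1 + c/m\<close>.\<close>

lemma beats_step:
  "\<exists>c K. c > 0 \<and> (\<forall>G m. r_graph r G \<and> family_free \<F> G \<and> card (verts G) = Suc m \<and> m \<ge> K \<and> \<tau> \<le> dens G \<and>
     G \<notin> Col r P \<longrightarrow> (\<exists>v\<in>verts G. dens G + c / Suc m \<le> dens (del_vertex v G) \<and>
       (beats G \<longrightarrow> strictly_beats (del_vertex v G))))"
proof -
  obtain c K\<^sub>1 where c: "c > 0" and K1: "\<And>G. r_graph r G \<Longrightarrow> family_free \<F> G \<Longrightarrow> card (verts G) \<ge> K\<^sub>1 \<Longrightarrow>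
      \<tau> \<le> dens G \<Longrightarrow> G \<notin> Col r P \<Longrightarrow>
      \<exists>v\<in>verts G. dens G * (1 + c / card (verts G)) \<le> dens (del_vertex v G)"
    using deletion_step by blast
  obtain K\<^sub>2 where K2: "\<And>H. H \<in> Col r P \<Longrightarrow> card (verts H) \<ge> K\<^sub>2 \<Longrightarrow> \<tau> \<le> dens H \<Longrightarrow>
     \<exists>H'\<in>Col r P. card (verts H') = Suc (card (verts H)) \<and>
        dens H * ((1 + r / card (verts H)) * (1 - r / (card (verts H) + 1))) \<le> dens H'"
    using Col_cloning_step by blast
  \<comment> \<open>From this order on the deletion gain outweighs the cloning loss; the summand 1
    makes the inequality strict.\<close>
  obtain K\<^sub>3 where K3: "\<And>k. k \<ge> K\<^sub>3 \<Longrightarrow> r * (r - 1) * (1 + c) + 1 \<le> real k * c"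
    using ex_linear_bound[OF c] by blast
  have "\<exists>v\<in>verts G. dens G + \<tau> * c / Suc m \<le> dens (del_vertex v G) \<and>
       (beats G \<longrightarrow> strictly_beats (del_vertex v G))"
    if G: "r_graph r G" "family_free \<F> G" "card (verts G) = Suc m" "m \<ge> max K\<^sub>1 (max K\<^sub>2 (max K\<^sub>3 1))"
      "\<tau> \<le> dens G" "G \<notin> Col r P" for G m
  proof -
    obtain v where v: "v \<in> verts G" "dens G * (1 + c / Suc m) \<le> dens (del_vertex v G)"
      using K1[OF G(1,2) _ G(5,6)] G(3,4) by auto
    have cd: "card (verts (del_vertex v G)) = m" using v G r_graph_finite_verts[OF G(1)] by simp
    have "\<tau> * (c / Suc m) \<le> dens G * (c / Suc m)" using G c by (intro mult_right_mono) auto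
    then have gain: "dens G + \<tau> * c / Suc m \<le> dens (del_vertex v G)"
      using v(2) by (simp add: distrib_left)
    have "strictly_beats (del_vertex v G)" if "beats G"
      unfolding strictly_beats_def cd
    proof (intro ballI impI)
      fix H assume H: "H \<in> Col r P" "card (verts H) = m"
      show "dens H < dens (del_vertex v G)"
      proof (cases "\<tau> \<le> dens H")
        \<comment> \<open>The cloning bound assumes density at least \<tau>; below that,
          \<open>G\<close> is already denser and deletion only adds to it.\<close>
        case False
        moreover have "0 < \<tau> * c / Suc m" using c tau_pos by simp
        ultimately show ?thesis using gain G(5) by linarith
      next
        case True
        define q where "q = (1 + r / m) * (1 - r / (m + 1))"
        have m: "m \<ge> 1" using G by simp
        obtain H' where H': "H' \<in> Col r P" "card (verts H') = Suc m" "dens H * q \<le> dens H'"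
          using K2[OF H(1) _ True] H(2) G(4) by (auto simp: q_def)
        \<comment> \<open>The enlarged graph \<open>H'\<close> has the order of \<open>G\<close>, so
          \<open>beats G\<close> applies to it.\<close>
        have le: "dens H * q \<le> dens G" using H' \<open>beats G\<close> G(3) unfolding beats_def by fastforce
        have q: "q * (1 + c / Suc m) > 1"
        proof -
          have "m * c > r * (r - 1) * (1 + c)" using K3[of m] G(4) by linarith
          moreover have "r * (r - 1) * (1 + c / Suc m) \<le> r * (r - 1) * (1 + c)"
            using c r by (intro mult_left_mono) (auto simp: field_simps)
          ultimately have "m * c > r * (r - 1) * (1 + c / Suc m)" by linarith
          moreover have m0: "real m + real m * real m > 0"
            using m by (intro add_pos_nonneg) auto
          \<comment> \<open>This uses \<open>q = 1 - r * (r - 1) / (m * (m + 1))\<close>.\<close>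
          have "q * (1 + c / Suc m) =
              1 + (m * c - r * (r - 1) * (1 + c / Suc m)) / (m * Suc m)"
            using m r m0 by (simp add: q_def divide_simps of_nat_diff) (simp add: algebra_simps)
          ultimately show ?thesis using m0 by (simp add: algebra_simps)
        qed
        have "dens H * 1 < dens H * (q * (1 + c / Suc m))"
          using q True tau_pos by (intro mult_strict_left_mono) auto
        also have "\<dots> = (dens H * q) * (1 + c / Suc m)" by simp
        also have "\<dots> \<le> dens G * (1 + c / Suc m)" using le c by (intro mult_right_mono) auto
        finally show ?thesis using v(2) by simp
      qed
    qed
    then show ?thesis using v(1) gain by blast
  qed
  moreover have "\<tau> * c > 0" using c tau_pos by simp
  ultimately show ?thesis by blast
qed

text \<open>Deletions from order \<open>n\<close> down to \<open>L\<close> would add at least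
  \<open>c\<close> times a harmonic sum, which for large \<open>n\<close> exceeds every possible
  density at order \<open>L\<close>; so the process stops at a colorable graph. The case
  \<open>G' = G\<close> means that nothing was deleted.\<close>

lemma reduction_to_Col:
  "\<exists>K. \<forall>L\<ge>K. \<exists>N. \<forall>G. r_graph r G \<and> family_free \<F> G \<and> card (verts G) \<ge> N \<and> \<tau> \<le> dens G \<longrightarrow>
     (\<exists>G'\<in>Col r P. card (verts G') \<ge> L \<and> \<tau> \<le> dens G' \<and> (G' = G \<or> (beats G \<longrightarrow> strictly_beats G')))"
proof -
  obtain c K where c: "c > 0" and K: "\<And>G m. r_graph r G \<Longrightarrow> family_free \<F> G \<Longrightarrow>
      card (verts G) = Suc m \<Longrightarrow> m \<ge> K \<Longrightarrow> \<tau> \<le> dens G \<Longrightarrow> G \<notin> Col r P \<Longrightarrow>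
      \<exists>v\<in>verts G. dens G + c / Suc m \<le> dens (del_vertex v G) \<and>
        (beats G \<longrightarrow> strictly_beats (del_vertex v G))"
    using beats_step by blast
  have "\<exists>N. \<forall>G. r_graph r G \<and> family_free \<F> G \<and> card (verts G) \<ge> N \<and> \<tau> \<le> dens G \<longrightarrow>
     (\<exists>G'\<in>Col r P. card (verts G') \<ge> L \<and> \<tau> \<le> dens G' \<and> (G' = G \<or> (beats G \<longrightarrow> strictly_beats G')))"
    if L: "L \<ge> max K 1" for L
  proof -
    \<comment> \<open>Induction on the order; the difference of harmonic numbers records the gains
      \<open>c / j\<close> of the deletions at each order \<open>j\<close>.\<close>
    have red: "\<exists>G'. r_graph r G' \<and> family_free \<F> G' \<and> L \<le> card (verts G') \<and> \<tau> \<le> dens G' \<and>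
        (G' \<in> Col r P \<or> card (verts G') = L) \<and>
        dens G + c * (harm n - harm (card (verts G'))) \<le> dens G' \<and>
        (G' = G \<or> (beats G \<longrightarrow> strictly_beats G'))"
      if "n \<ge> L" "r_graph r G" "family_free \<F> G" "card (verts G) = n" "\<tau> \<le> dens G" for n G
      using that
    proof (induction n arbitrary: G rule: dec_induct)
      case base
      then show ?case by (intro exI[of _ G]) simp
    next
      case (step m)
      show ?case
      proof (cases "G \<in> Col r P")
        case True
        then show ?thesis using step by (intro exI[of _ G]) simp
      next
        case False
        then obtain v where v: "v \<in> verts G" "dens G + c / Suc m \<le> dens (del_vertex v G)"
            "beats G \<longrightarrow> strictly_beats (del_vertex v G)"
          using K[of G m] step L by auto
        have cd: "card (verts (del_vertex v G)) = m"
          using v step.prems r_graph_finite_verts by simp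
        have "c / Suc m \<ge> 0" using c by simp
        then have td: "\<tau> \<le> dens (del_vertex v G)" using v(2) step.prems(4) by linarith
        obtain G' where G': "r_graph r G'" "family_free \<F> G'" "L \<le> card (verts G')" "\<tau> \<le> dens G'"
          "G' \<in> Col r P \<or> card (verts G') = L"
          "dens (del_vertex v G) + c * (harm m - harm (card (verts G'))) \<le> dens G'"
          "G' = del_vertex v G \<or> (beats (del_vertex v G) \<longrightarrow> strictly_beats G')"
          using step.IH[OF r_graph_del_vertex[OF step.prems(1)]
              family_free_del_vertex[OF step.prems(2)] cd td] by blast
        \<comment> \<open>A strict win is in particular a win, so the property passes through all
          later deletions.\<close>
        have "beats (del_vertex v G)" if "strictly_beats (del_vertex v G)"
          using that unfolding beats_def strictly_beats_def by (meson less_imp_le)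
        then have "beats G \<longrightarrow> strictly_beats G'" using v(3) G'(7) by auto
        moreover have "dens G + c * (harm (Suc m) - harm (card (verts G'))) \<le> dens G'"
          using G'(6) v(2) by (simp add: harm_Suc algebra_simps divide_inverse)
        ultimately show ?thesis using G' by blast
      qed
    qed
    \<comment> \<open>An upper bound for the density of every graph on \<open>L\<close>
      vertices.\<close>
    define B where "B = real (L ^ r) / (fact r * real (L choose r))"
    have "filterlim (\<lambda>n. harm n :: real) at_top sequentially" by (rule harm_at_top)
    then have "\<forall>\<^sub>F n in sequentially. B / c + harm L < (harm n :: real)"
      by (simp add: filterlim_at_top_dense)
    then obtain N where N: "\<And>n. n \<ge> N \<Longrightarrow> B / c + harm L < (harm n :: real)"
      unfolding eventually_sequentially by blast
    have "\<exists>G'\<in>Col r P. card (verts G') \<ge> L \<and> \<tau> \<le> dens G' \<and> (G' = G \<or> (beats G \<longrightarrow> strictly_beats G'))"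
      if G: "r_graph r G" "family_free \<F> G" "card (verts G) \<ge> max N L" "\<tau> \<le> dens G" for G
    proof -
      let ?n = "card (verts G)"
      obtain G' where G': "r_graph r G'" "family_free \<F> G'" "L \<le> card (verts G')" "\<tau> \<le> dens G'"
        "G' \<in> Col r P \<or> card (verts G') = L"
        "dens G + c * (harm ?n - harm (card (verts G'))) \<le> dens G'"
        "G' = G \<or> (beats G \<longrightarrow> strictly_beats G')"
        using red[OF _ G(1,2) refl G(4)] G(3) by auto
      have "G' \<in> Col r P"
      proof (rule ccontr)
        assume "G' \<notin> Col r P"
        then have cL: "card (verts G') = L" using G'(5) by blast
        then have "verts G' \<noteq> {}" using L by auto
        then have "dens G' \<le> B"
          using radius_density_le[of \<alpha> r G'] alpha G'(1) cL by (simp add: B_def)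
        moreover have "B < c * (harm ?n - harm L)"
          using N[of ?n] G(3) c by (simp add: field_simps)
        ultimately show False using G'(6)[unfolded cL] G(4) tau_pos by linarith
      qed
      then show ?thesis using G' by blast
    qed
    then show ?thesis by blast
  qed
  then show ?thesis by blast
qed

text \<open>A graph attaining the Turan number has at least the Turan density, already with constant
  weights.\<close>

lemma ex_dense_family_free:
  assumes "n \<ge> r"
  shows "\<exists>G. r_graph r G \<and> family_free \<F> G \<and> card (verts G) = n \<and> \<tau> \<le> dens G"
proof -
  have ex: "\<exists>G. r_graph r G \<and> card (verts G) = k \<and> family_free \<F> G" for k
    using empty_graph_Col[OF pattern, of "{..<k}"] Col_r_graph Col_family_free
    by (intro exI[of _ "({..<k}, {})"]) auto
  obtain G where G: "r_graph r G" "card (verts G) = n" "family_free \<F> G"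
      "card (edges G) = turan_number r n \<F>"
    using ex[of n] turan_number_attained by metis
  have "verts G \<noteq> {}" using G assms r by auto
  then have "turan_number r n \<F> / (n choose r) \<le> dens G"
    using edge_density_le_radius_density[of \<alpha> r G] alpha G by simp
  then show ?thesis using turan_density_le[OF ex assms] G by fastforce
qed

text \<open>Reducing a dense free graph of large order gives a dense colorable graph with at least
  \<open>n\<close> vertices; deletions inside \<open>Col r P\<close> then bring the order down to
  exactly \<open>n\<close>.\<close>

lemma ex_dense_Col:
  "\<exists>K. \<forall>n\<ge>K. \<exists>H\<in>Col r P. card (verts H) = n \<and> \<tau> \<le> dens H"
proof -
  obtain K\<^sub>1 where K1: "\<forall>G\<in>Col r P. card (verts G) \<ge> K\<^sub>1 \<and> \<tau> \<le> dens G \<longrightarrow>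
     (\<exists>v\<in>verts G. \<tau> \<le> dens (del_vertex v G))"
    using Col_deletion_step by (rule exE)
  obtain K\<^sub>2 where K2: "\<forall>L\<ge>K\<^sub>2. \<exists>N. \<forall>G. r_graph r G \<and> family_free \<F> G \<and> card (verts G) \<ge> N \<and> \<tau> \<le> dens G \<longrightarrow>
     (\<exists>G'\<in>Col r P. card (verts G') \<ge> L \<and> \<tau> \<le> dens G' \<and> (G' = G \<or> (beats G \<longrightarrow> strictly_beats G')))"
    using reduction_to_Col by (rule exE)
  have "\<exists>H\<in>Col r P. card (verts H) = n \<and> \<tau> \<le> dens H" if n: "n \<ge> max K\<^sub>1 K\<^sub>2" for n
  proof -
    have "n \<ge> K\<^sub>2" using n by simp
    then obtain N where N: "\<forall>G. r_graph r G \<and> family_free \<F> G \<and> card (verts G) \<ge> N \<and> \<tau> \<le> dens G \<longrightarrow>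
       (\<exists>G'\<in>Col r P. card (verts G') \<ge> n \<and> \<tau> \<le> dens G' \<and> (G' = G \<or> (beats G \<longrightarrow> strictly_beats G')))"
      using K2 by (elim allE[of _ n] impE exE)
    obtain G where "r_graph r G" "family_free \<F> G" "card (verts G) = max N r" "\<tau> \<le> dens G"
      using ex_dense_family_free[of "max N r"] by auto
    then obtain G' where G': "G' \<in> Col r P" "card (verts G') \<ge> n" "\<tau> \<le> dens G'"
      using spec[OF N, of G] by auto
    have "\<exists>H\<in>Col r P. card (verts H) = n \<and> \<tau> \<le> dens H"
      if "k \<ge> n" "H \<in> Col r P" "card (verts H) = k" "\<tau> \<le> dens H" for k H
      using that
    proof (induction k arbitrary: H rule: dec_induct)
      case (step k)
      then obtain v where v: "v \<in> verts H" "\<tau> \<le> dens (del_vertex v H)"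
        using bspec[OF K1, of H] n by auto
      have "card (verts (del_vertex v H)) = k"
        using v step.prems r_graph_finite_verts[OF Col_r_graph] by simp
      then show ?case using step.IH Col_del_vertex step.prems(1) v(2) by blast
    qed blast
    then show ?thesis using G' by blast
  qed
  then show ?thesis by blast
qed

lemma dens_le_iff:
  assumes "card (verts H) = card (verts G)" "card (verts G) \<ge> r"
  shows "dens H \<le> dens G \<longleftrightarrow> spectral_radius \<alpha> r H \<le> spectral_radius \<alpha> r G"
proof -
  have "fact r * real (card (verts G) choose r) > 0" "real (card (verts G)) powr (r / \<alpha>) > 0"
    using assms r by (auto simp: zero_less_binomial_iff)
  then show ?thesis
    by (simp add: radius_density_def scaled_radius_def assms(1) divide_le_cancel)
qed

text \<open>A graph reaching the colorable maximum beats all colorable graphs of its order. Had the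
  reduction deleted a vertex, it would end at a colorable graph strictly denser than itself; so
  \<open>G\<close> is colorable from the start.\<close>

lemma extremal_is_colorable:
  "\<exists>n\<^sub>0. \<forall>n\<ge>n\<^sub>0. \<forall>G. r_graph r G \<and> card (verts G) = n \<and> family_free \<F> G \<and>
     family_spectral_radius \<alpha> r (Col r P) n \<le> spectral_radius \<alpha> r G \<longrightarrow> G \<in> Col r P"
proof -
  obtain K\<^sub>1 where K1: "\<And>n. n \<ge> K\<^sub>1 \<Longrightarrow> \<exists>H\<in>Col r P. card (verts H) = n \<and> \<tau> \<le> dens H"
    using ex_dense_Col by blast
  obtain L where "\<exists>N. \<forall>G. r_graph r G \<and> family_free \<F> G \<and> card (verts G) \<ge> N \<and> \<tau> \<le> dens G \<longrightarrow>
     (\<exists>G'\<in>Col r P. card (verts G') \<ge> L \<and> \<tau> \<le> dens G' \<and> (G' = G \<or> (beats G \<longrightarrow> strictly_beats G')))"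
    using reduction_to_Col by blast
  then obtain N where N: "\<And>G. r_graph r G \<Longrightarrow> family_free \<F> G \<Longrightarrow> card (verts G) \<ge> N \<Longrightarrow> \<tau> \<le> dens G \<Longrightarrow>
     \<exists>G'\<in>Col r P. G' = G \<or> (beats G \<longrightarrow> strictly_beats G')"
    by blast
  have "G \<in> Col r P" if G: "r_graph r G" "card (verts G) \<ge> max K\<^sub>1 (max N r)" "family_free \<F> G"
      "family_spectral_radius \<alpha> r (Col r P) (card (verts G)) \<le> spectral_radius \<alpha> r G" for G
  proof -
    have "beats G"
      unfolding beats_def
    proof (intro ballI impI)
      fix H assume H: "H \<in> Col r P" "card (verts H) = card (verts G)"
      then have "spectral_radius \<alpha> r H \<le> spectral_radius \<alpha> r G"
        using spectral_radius_le_family[OF H, of \<alpha>] G(4) by linarith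
      then show "dens H \<le> dens G" using dens_le_iff[OF H(2)] G(2) by simp
    qed
    \<comment> \<open>At this order there is a colorable graph of density at least \<tau>, and
      \<open>G\<close> is at least as dense.\<close>
    then have "\<tau> \<le> dens G" using K1[of "card (verts G)"] G(2) unfolding beats_def by fastforce
    then obtain G' where "G' \<in> Col r P" "G' = G \<or> strictly_beats G'"
      using N[OF G(1,3)] G(2) \<open>beats G\<close> by auto
    then show ?thesis unfolding strictly_beats_def by blast
  qed
  then show ?thesis by blast
qed

end

theorem theorem4p2:
  fixes \<alpha> :: real and r :: nat and P :: pattern and \<F> :: "hypergraph set"
  assumes "\<alpha> > 1" and "r \<ge> 2"
    and "is_pattern r P"
    and "\<forall>F\<in>\<F>. r_graph r F \<and> \<not> has_isolated_vertex F"
    and "degree_stable r \<F> (Col r P)"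
  shows "\<exists>n\<^sub>0::nat. \<forall>n\<ge>n\<^sub>0. \<forall>G. r_graph r G \<and> card (verts G) = n \<and> family_free \<F> G \<longrightarrow>
           spectral_radius \<alpha> r G \<le> family_spectral_radius \<alpha> r (Col r P) n \<and>
           (spectral_radius \<alpha> r G = family_spectral_radius \<alpha> r (Col r P) n \<longrightarrow> colorable P G)"
proof -
  interpret stable_family \<alpha> r P \<F> using assms by unfold_locales
  obtain n\<^sub>0 where n0: "\<And>n G. n \<ge> n\<^sub>0 \<Longrightarrow> r_graph r G \<Longrightarrow> card (verts G) = n \<Longrightarrow> family_free \<F> G \<Longrightarrow>
     family_spectral_radius \<alpha> r (Col r P) n \<le> spectral_radius \<alpha> r G \<Longrightarrow> G \<in> Col r P"
    using extremal_is_colorable by blast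
  show ?thesis
  proof (intro exI[of _ n\<^sub>0] allI impI, elim conjE)
    fix n G assume G: "n\<^sub>0 \<le> n" "r_graph r G" "card (verts G) = n" "family_free \<F> G"
    show "spectral_radius \<alpha> r G \<le> family_spectral_radius \<alpha> r (Col r P) n \<and>
       (spectral_radius \<alpha> r G = family_spectral_radius \<alpha> r (Col r P) n \<longrightarrow> colorable P G)"
    proof (cases "family_spectral_radius \<alpha> r (Col r P) n \<le> spectral_radius \<alpha> r G")
      \<comment> \<open>Both claims come from this case: a graph reaching the family maximum is
        colorable, hence one of those over which the maximum is taken.\<close>
      case True
      then have "G \<in> Col r P" using n0 G by blast
      then show ?thesis using spectral_radius_le_family[of G r P n \<alpha>] G(3) by (simp add: Col_def)
    qed auto
  qed
qed

end
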